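(* The $2$-colour parity descends to a parity on $2$-colourable oriented free links. That is, for a $2$-colourable oriented simple Gauss diagram $G$ with $2$-colouring $\mathscr{C}$, the function $\mathfrak{p}_{\mathscr{C}}$ on the chords of $G$ (defined in the context) agrees with the $2$-colour parity of classical crossings when $G=G(D)$ for an oriented virtual link diagram $D$ with the corresponding $2$-colouring, and, with $2$-colourings transported along moves, it satisfies the parity axioms with respect to the moves defining free links.
   Context: A simple Gauss diagram is a finite disjoint union of circles (core circles) together with finitely many chords, each joining two distinct points (its endpoints) of the core circles, with all endpoints distinct; the two endpoints of a chord may lie on the same or different core circles, and chords carry no arrows or signs. It is oriented if each core circle is oriented. A virtual link diagram $D$ is a generic immersion of circles in the plane with double points marked as classical or virtual crossings; its simple Gauss diagram $G(D)$ has one core circle for each component, with the classical crossings marked along it in the order they are met (virtual crossings ignored), and one chord for each classical crossing joining its two occurrences. If $D$ is oriented so is $G(D)$. A free link is an equivalence class of simple Gauss diagrams up to the following local moves: (I) adding or removing a chord whose two endpoints are adjacent on a core circle; (II) adding or removing two chords $c_1,c_2$ such that one endpoint of $c_1$ is adjacent to one endpoint of $c_2$, and the other endpoint of $c_1$ is adjacent to the other endpoint of $c_2$; (III) for three chords $c_1,c_2,c_3$ whose six endpoints form three pairs of adjacent endpoints, one pair from each two of the three chords, exchanging the order of the two endpoints in each of the three pairs. A $2$-colouring of $G$ is a colouring of the intervals of the complement of the chord endpoints in the core circles, each exactly one of two colours, such that adjacent intervals (those separated by one chord endpoint) have opposite colours. A free link is $2$-colourable if it has a representative with a $2$-colouring.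 If $G'$ is obtained from $G$ by a move, a $2$-colouring of $G$ induces the $2$-colouring of $G'$ agreeing with it away from the move. A $2$-colouring of a virtual link diagram $D$ is a colouring of the arcs running between classical crossings (passing straight through virtual crossings; a component without classical crossings is a single arc), each exactly one of two colours, such that the colour changes when passing straight through any classical crossing. These correspond to $2$-colourings of $G(D)$ by identifying arcs of $D$ with intervals of $G(D)$. The $2$-colour parity of a classical crossing of an oriented $D$ is $0$ (even) if the two arcs oriented into the crossing have different colours and $1$ (odd) if they have the same colour. For a chord $c$ of an oriented $G$ with $2$-colouring $\mathscr{C}$: $\mathfrak{p}_{\mathscr{C}}(c)=0$ (even) if the intervals immediately preceding the two endpoints of $c$ (with respect to the orientation) have different colours, and $\mathfrak{p}_{\mathscr{C}}(c)=1$ (odd) if they have the same colour. Parity axioms (for chords, with respect to the moves above): (0) chords not involved in a move do not change parity; (1) a chord eliminated by a move (I) is even; (2) two chords eliminated by a move (II) have the same parity; (3) in a move (III) the three chords involved are all odd, or all even, or exactly two are odd, and their parities are unchanged by the move. *)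

theory Defs
  imports "HOL-Analysis.Analysis"
begin

section \<open>Simple Gauss diagrams\<close>

text \<open>The core circles are copies of the unit circle in the complex plane, indexed by a finite set
  of naturals (a discrete space, so that distinct circles lie in distinct components).
  A chord is the set of its two endpoints.\<close>

type_synonym point = "nat \<times> complex"
type_synonym chord = "point set"

definition circle_union :: "nat set \<Rightarrow> point set" where
  "circle_union I = I \<times> sphere 0 1"

record gauss =
  circles :: "nat set"
  chords :: "chord set"

abbreviation core :: "gauss \<Rightarrow> point set" where
  "core G \<equiv> circle_union (circles G)"

definition endpoints :: "gauss \<Rightarrow> point set" where
  "endpoints G = \<Union> (chords G)"

definition simple_gauss :: "gauss \<Rightarrow> bool" where
  "simple_gauss G \<longleftrightarrow> finite (circles G) \<and> finite (chords G) \<and>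
     (\<forall>c\<in>chords G. c \<subseteq> core G \<and> card c = 2) \<and> pairwise disjnt (chords G)"

definition intervals :: "gauss \<Rightarrow> point set set" where
  "intervals G = components (core G - endpoints G)"

definition interval_of :: "gauss \<Rightarrow> point \<Rightarrow> point set" where
  "interval_of G x = connected_component_set (core G - endpoints G) x"

text \<open>The point reached from \<open>p\<close> by turning through the angle \<open>s\<close>, anticlockwise for \<open>s > 0\<close>.\<close>

definition shift :: "point \<Rightarrow> real \<Rightarrow> point" where
  "shift p s = (fst p, snd p * cis s)"

text \<open>The interval reached on leaving \<open>p\<close> anticlockwise (\<open>e = 1\<close>) or clockwise (\<open>e = -1\<close>).\<close>

definition side :: "gauss \<Rightarrow> point \<Rightarrow> real \<Rightarrow> point set" where
  "side G p e = (THE A. A \<in> intervals G \<and> (\<forall>\<^sub>F s in at_right 0. shift p (e * s) \<in> A))"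

text \<open>An orientation of circle \<open>i\<close> is the sign \<open>1\<close> (anticlockwise) or \<open>-1\<close> (clockwise).\<close>

definition orientation :: "nat set \<Rightarrow> (nat \<Rightarrow> real) \<Rightarrow> bool" where
  "orientation I w \<longleftrightarrow> (\<forall>i\<in>I. w i = 1 \<or> w i = -1)"

definition preceding :: "gauss \<Rightarrow> (nat \<Rightarrow> real) \<Rightarrow> point \<Rightarrow> point set" where
  "preceding G w p = side G p (- w (fst p))"

text \<open>The two colours are the truth values; only the values of a colouring on \<open>intervals G\<close>
  matter.\<close>

type_synonym colouring = "point set \<Rightarrow> bool"

definition two_colouring :: "gauss \<Rightarrow> colouring \<Rightarrow> bool" where
  "two_colouring G C \<longleftrightarrow> (\<forall>p\<in>endpoints G. C (side G p 1) \<noteq> C (side G p (-1)))"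

definition chord_parity :: "gauss \<Rightarrow> (nat \<Rightarrow> real) \<Rightarrow> colouring \<Rightarrow> chord \<Rightarrow> nat" where
  "chord_parity G w C c =
     (if \<forall>p\<in>c. \<forall>q\<in>c. C (preceding G w p) = C (preceding G w q) then 1 else 0)"


section \<open>Moves and free links\<close>

text \<open>\<open>p\<close> and \<open>q\<close> are the two ends of the interval \<open>A\<close>. If they are the only endpoints on their
  circle, there are two such intervals.\<close>

definition adjacent_via :: "gauss \<Rightarrow> point set \<Rightarrow> point \<Rightarrow> point \<Rightarrow> bool" where
  "adjacent_via G A p q \<longleftrightarrow> p \<in> endpoints G \<and> q \<in> endpoints G \<and> p \<noteq> q \<and> A \<in> intervals G \<and>
     (side G p 1 = A \<and> side G q (-1) = A \<or> side G q 1 = A \<and> side G p (-1) = A)"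

text \<open>In each move, \<open>R\<close> is the region of the core circles in which the move takes place.
  Moves I and II are given in the removing direction.\<close>

definition move1 :: "gauss \<Rightarrow> chord \<Rightarrow> point set \<Rightarrow> gauss \<Rightarrow> bool" where
  "move1 G c R G' \<longleftrightarrow> c \<in> chords G \<and> G' = G\<lparr>chords := chords G - {c}\<rparr> \<and>
     (\<exists>p q A. c = {p, q} \<and> adjacent_via G A p q \<and> R = A \<union> {p, q})"

definition move2 :: "gauss \<Rightarrow> chord \<Rightarrow> chord \<Rightarrow> point set \<Rightarrow> gauss \<Rightarrow> bool" where
  "move2 G c1 c2 R G' \<longleftrightarrow> c1 \<in> chords G \<and> c2 \<in> chords G \<and> c1 \<noteq> c2 \<and>
     G' = G\<lparr>chords := chords G - {c1, c2}\<rparr> \<and>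
     (\<exists>p1 q1 p2 q2 A B. c1 = {p1, q1} \<and> c2 = {p2, q2} \<and>
        adjacent_via G A p1 p2 \<and> adjacent_via G B q1 q2 \<and>
        R = A \<union> B \<union> {p1, q1, p2, q2})"

text \<open>Exchanging two adjacent endpoints means that the positions stay fixed while the chords ending
  there are exchanged; \<open>c1'\<close>, \<open>c2'\<close>, \<open>c3'\<close> are the chords \<open>c1\<close>, \<open>c2\<close>, \<open>c3\<close> after the move.\<close>

definition move3 ::
  "gauss \<Rightarrow> chord \<times> chord \<times> chord \<Rightarrow> point set \<Rightarrow> gauss \<Rightarrow> chord \<times> chord \<times> chord \<Rightarrow> bool" where
  "move3 G cs R G' cs' \<longleftrightarrow> (\<exists>a1 a2 b1 b2 d1 d2 A B E c1 c2 c3 c1' c2' c3'.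
     cs = (c1, c2, c3) \<and> cs' = (c1', c2', c3') \<and>
     {c1, c2, c3} \<subseteq> chords G \<and> c1 \<noteq> c2 \<and> c1 \<noteq> c3 \<and> c2 \<noteq> c3 \<and>
     c1 = {a1, a2} \<and> c2 = {b1, b2} \<and> c3 = {d1, d2} \<and>
     adjacent_via G A a1 b1 \<and> adjacent_via G B a2 d1 \<and> adjacent_via G E b2 d2 \<and>
     c1' = {b1, d1} \<and> c2' = {a1, d2} \<and> c3' = {a2, b2} \<and>
     G' = G\<lparr>chords := chords G - {c1, c2, c3} \<union> {c1', c2', c3'}\<rparr> \<and>
     R = A \<union> B \<union> E \<union> {a1, a2, b1, b2, d1, d2})"

definition move :: "point set \<Rightarrow> gauss \<Rightarrow> gauss \<Rightarrow> bool" where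
  "move R G G' \<longleftrightarrow> (\<exists>c. move1 G c R G') \<or> (\<exists>c1 c2. move2 G c1 c2 R G') \<or>
     (\<exists>cs cs'. move3 G cs R G' cs')"

text \<open>Gauss diagrams are considered up to homeomorphism. A homeomorphism of the core circles respects
  the orientations if, for all \<open>p\<close>, it maps points just after (\<open>e = 1\<close>) or just before (\<open>e = -1\<close>)
  \<open>p\<close> to points just after or just before \<open>f p\<close>.\<close>

definition oriented_iso ::
  "(point \<Rightarrow> point) \<Rightarrow> gauss \<times> (nat \<Rightarrow> real) \<Rightarrow> gauss \<times> (nat \<Rightarrow> real) \<Rightarrow> bool" where
  "oriented_iso f X X' \<longleftrightarrow> (case (X, X') of ((G, w), (G', w')) \<Rightarrow>
     (\<exists>g. homeomorphism (core G) (core G') f g) \<and> chords G' = image f ` chords G \<and>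
     (\<forall>p\<in>core G. \<forall>e\<in>{1, -1}. \<forall>\<^sub>F s in at_right 0. \<exists>u\<in>{0<..<pi}.
        f (shift p (e * w (fst p) * s)) = shift (f p) (e * w' (fst (f p)) * u)))"

definition oriented_diagrams :: "(gauss \<times> (nat \<Rightarrow> real)) set" where
  "oriented_diagrams = {(G, w). simple_gauss G \<and> orientation (circles G) w}"

definition free_step :: "(gauss \<times> (nat \<Rightarrow> real)) rel" where
  "free_step = {((G, w), (G', w')).
     (G, w) \<in> oriented_diagrams \<and> (G', w') \<in> oriented_diagrams \<and>
     ((\<exists>R. move R G G') \<and> w' = w \<or> (\<exists>f. oriented_iso f (G, w) (G', w')))}"

definition oriented_free_links :: "(gauss \<times> (nat \<Rightarrow> real)) set set" where
  "oriented_free_links = oriented_diagrams // (free_step \<union> free_step\<inverse>)\<^sup>*"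

definition two_colourable :: "(gauss \<times> (nat \<Rightarrow> real)) set \<Rightarrow> bool" where
  "two_colourable L \<longleftrightarrow> (\<exists>(G, w)\<in>L. \<exists>C. two_colouring G C)"


section \<open>Transport of colourings and parities\<close>

text \<open>The colourings agree away from the region \<open>R\<close> of a move between \<open>G\<close> and \<open>G'\<close>.\<close>

definition transported :: "point set \<Rightarrow> gauss \<Rightarrow> colouring \<Rightarrow> gauss \<Rightarrow> colouring \<Rightarrow> bool" where
  "transported R G C G' C' \<longleftrightarrow> two_colouring G C \<and> two_colouring G' C' \<and>
     (\<forall>x \<in> core G - (endpoints G \<union> endpoints G' \<union> R). C' (interval_of G' x) = C (interval_of G x))"

definition induces_colourings :: "point set \<Rightarrow> gauss \<Rightarrow> gauss \<Rightarrow> bool" where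
  "induces_colourings R G G' \<longleftrightarrow> (\<forall>C. two_colouring G C \<longrightarrow>
     (\<exists>C'. transported R G C G' C' \<and>
        (\<forall>C''. transported R G C G' C'' \<longrightarrow> (\<forall>A\<in>intervals G'. C'' A = C' A))))"

text \<open>A parity \<open>P\<close> on a free link is defined on the chords of all its representatives, depending on a
  2-colouring that is transported along the moves. The chords not involved in a move are those
  common to both diagrams. The clause for \<open>oriented_iso\<close> says that \<open>P\<close> is well defined on
  homeomorphism classes.\<close>

definition parity_on ::
  "(gauss \<times> (nat \<Rightarrow> real)) set \<Rightarrow> (gauss \<Rightarrow> (nat \<Rightarrow> real) \<Rightarrow> colouring \<Rightarrow> chord \<Rightarrow> nat) \<Rightarrow> bool"
  where
  "parity_on L P \<longleftrightarrow>
     (\<forall>(G, w)\<in>L. \<forall>C. two_colouring G C \<longrightarrow> (\<forall>c\<in>chords G. P G w C c \<in> {0, 1})) \<and>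
     (\<forall>(G, w)\<in>L. \<forall>(G', w')\<in>L. \<forall>f C'. oriented_iso f (G, w) (G', w') \<and> two_colouring G' C' \<longrightarrow>
        two_colouring G (\<lambda>A. C' (f ` A)) \<and>
        (\<forall>c\<in>chords G. P G w (\<lambda>A. C' (f ` A)) c = P G' w' C' (f ` c))) \<and>
     (\<forall>(G, w)\<in>L. \<forall>R G' C C'. move R G G' \<and> transported R G C G' C' \<longrightarrow>
        (\<forall>c\<in>chords G \<inter> chords G'. P G' w C' c = P G w C c)) \<and>
     (\<forall>(G, w)\<in>L. \<forall>R G' C c. move1 G c R G' \<and> two_colouring G C \<longrightarrow> P G w C c = 0) \<and>
     (\<forall>(G, w)\<in>L. \<forall>R G' C c1 c2. move2 G c1 c2 R G' \<and> two_colouring G C \<longrightarrow>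
        P G w C c1 = P G w C c2) \<and>
     (\<forall>(G, w)\<in>L. \<forall>R G' C C' c1 c2 c3 c1' c2' c3'.
        move3 G (c1, c2, c3) R G' (c1', c2', c3') \<and> transported R G C G' C' \<longrightarrow>
        card {c \<in> {c1, c2, c3}. P G w C c = 1} \<in> {0, 2, 3} \<and>
        P G' w C' c1' = P G w C c1 \<and> P G' w C' c2' = P G w C c2 \<and> P G' w C' c3' = P G w C c3)"


section \<open>Virtual link diagrams\<close>

text \<open>\<open>classical D\<close> is the set of double points marked as classical; all others are virtual.\<close>

record vdiagram =
  comps :: "nat set"
  immersion :: "point \<Rightarrow> complex"
  classical :: "complex set"

definition strands :: "vdiagram \<Rightarrow> complex \<Rightarrow> point set" where
  "strands D x = {p \<in> circle_union (comps D). immersion D p = x}"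

definition crossings :: "vdiagram \<Rightarrow> complex set" where
  "crossings D = {x. \<exists>p\<in>strands D x. \<exists>q\<in>strands D x. p \<noteq> q}"

definition curve :: "vdiagram \<Rightarrow> nat \<Rightarrow> real \<Rightarrow> complex" where
  "curve D i t = immersion D (i, cis t)"

definition virtual_diagram :: "vdiagram \<Rightarrow> bool" where
  "virtual_diagram D \<longleftrightarrow> finite (comps D) \<and>
     (\<forall>i\<in>comps D. curve D i C1_differentiable_on UNIV \<and>
        (\<forall>t. vector_derivative (curve D i) (at t) \<noteq> 0)) \<and>
     finite (crossings D) \<and> (\<forall>x\<in>crossings D. card (strands D x) = 2) \<and>
     (\<forall>i\<in>comps D. \<forall>j\<in>comps D. \<forall>t u.
        (i, cis t) \<noteq> (j, cis u) \<and> curve D i t = curve D j u \<longrightarrow>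
        (\<forall>r. vector_derivative (curve D j) (at u) \<noteq> r *\<^sub>R vector_derivative (curve D i) (at t))) \<and>
     classical D \<subseteq> crossings D"

definition gauss_of :: "vdiagram \<Rightarrow> gauss" where
  "gauss_of D = \<lparr>circles = comps D, chords = strands D ` classical D\<rparr>"

text \<open>Arcs and their colourings live in the plane. An arc is traced out by a maximal connected part of
  the circles not meeting a classical crossing; \<open>arc_at D p e\<close> is the arc met on leaving the
  crossing \<open>immersion D p\<close> along the strand through \<open>p\<close>, in the direction \<open>e\<close>.\<close>

definition arcs :: "vdiagram \<Rightarrow> complex set set" where
  "arcs D = image (immersion D) `
     components {p \<in> circle_union (comps D). immersion D p \<notin> classical D}"

definition arc_at :: "vdiagram \<Rightarrow> point \<Rightarrow> real \<Rightarrow> complex set" where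
  "arc_at D p e =
     (THE a. a \<in> arcs D \<and> (\<forall>\<^sub>F s in at_right 0. immersion D (shift p (e * s)) \<in> a))"

definition diagram_colouring :: "vdiagram \<Rightarrow> (complex set \<Rightarrow> bool) \<Rightarrow> bool" where
  "diagram_colouring D K \<longleftrightarrow>
     (\<forall>x\<in>classical D. \<forall>p\<in>strands D x. K (arc_at D p 1) \<noteq> K (arc_at D p (-1)))"

definition arc_into :: "vdiagram \<Rightarrow> (nat \<Rightarrow> real) \<Rightarrow> point \<Rightarrow> complex set" where
  "arc_into D w p = arc_at D p (- w (fst p))"

definition crossing_parity ::
  "vdiagram \<Rightarrow> (nat \<Rightarrow> real) \<Rightarrow> (complex set \<Rightarrow> bool) \<Rightarrow> complex \<Rightarrow> nat" where
  "crossing_parity D w K x =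
     (if \<forall>p\<in>strands D x. \<forall>q\<in>strands D x. K (arc_into D w p) = K (arc_into D w q) then 1 else 0)"

definition corresponds :: "vdiagram \<Rightarrow> (complex set \<Rightarrow> bool) \<Rightarrow> colouring \<Rightarrow> bool" where
  "corresponds D K C \<longleftrightarrow> (\<forall>A\<in>intervals (gauss_of D). K (immersion D ` A) = C A)"

end

theory Submission
  imports Defs
begin

text \<open>A 2-colouring is a function on the points of the core circles that is locally constant
  off the chord endpoints and flips at each of them. The region \<open>R\<close> of a move is a disjoint union
  of closed arcs, so its indicator flips exactly at the ends of these arcs, which are the endpoints
  the move deletes (moves I and II) or permutes (move III). Adding the indicator of \<open>R\<close> modulo 2
  therefore turns colourings on one side of a move I or II into colourings on the other side; for
  move III the endpoints, and hence the colourings, are unchanged. Uniqueness holds because two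
  colourings differ by a function without flips, which is constant on each circle, and \<open>R\<close> covers no
  whole circle. Since adjacent endpoints lie on the same circle, their preceding intervals have
  opposite colours, which gives the parity axioms. For a virtual link diagram, an arc determines
  its interval because only finitely many points of the circles lie over crossings.\<close>

section \<open>Sides of points\<close>

text \<open>The obstacle is that a move changes the intervals themselves: deleting an endpoint
  merges its two neighbours, so colourings before and after a move have different domains. Both
  become comparable as functions on the points of the common core circles, where flip sets add
  modulo 2. The price is that values at endpoints mean nothing: \<open>interval_of\<close> is empty
  there. Hence the statements speak of small positive angles on either side of a point, and
  \<open>germ\<close> turns such data back into a function that is constant on intervals. Only the
  set of endpoints matters for this, not their pairing into chords, so each move and its inverse is
  reduced to one description by a region and its end points. The pairing returns with the parity,
  which compares two colours: each adjacency in a move flips one of them. In move III the three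
  flips together make the number of even chords odd, so none or two of the three chords are
  odd.\<close>

lemma fst_shift [simp]: "fst (shift p s) = fst p"
  by (simp add: shift_def)

lemma shift_0 [simp]: "shift p 0 = p"
  by (simp add: shift_def)

lemma shift_shift: "shift (shift p s) t = shift p (s + t)"
  by (simp add: shift_def cis_mult mult.assoc)

lemma shift_in_circle_union [simp]: "shift p s \<in> circle_union I \<longleftrightarrow> p \<in> circle_union I"
  by (auto simp: shift_def circle_union_def norm_mult mem_Times_iff)

lemma continuous_on_shift: "continuous_on S (shift p)"
  unfolding shift_def by (intro continuous_intros)

lemma cis_inj:
  assumes "cis s = cis t" "\<bar>s - t\<bar> < 2 * pi"
  shows "s = t"
proof -
  have "cis (s - t) = 1"
    using assms(1) by (simp flip: cis_divide)
  then have "cos (s - t) = 1"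
    by (metis cis.sel(1) one_complex.sel(1))
  then obtain n :: int where n: "s - t = of_int n * 2 * pi"
    using cos_one_2pi_int by (metis mult.assoc)
  have "\<bar>of_int n\<bar> * (2 * pi) < 1 * (2 * pi)"
    using assms(2) n by (simp add: abs_mult)
  then have "n = 0"
    by (simp only: mult_less_cancel_right) (use pi_gt_zero in linarith)
  then show ?thesis using n by simp
qed

lemma shift_eq_iff:
  assumes "p \<in> circle_union I"
  shows "shift p s = shift p t \<longleftrightarrow> cis s = cis t"
  using assms by (auto simp: shift_def circle_union_def)

text \<open>While the angle runs through \<open>(0, pi)\<close> each point is met at most once, so
  it is avoided below that angle. The point \<open>p\<close> itself may belong to \<open>F\<close>,
  because the angle 0 is excluded.\<close>

lemma eventually_shift_notin:
  assumes "finite F" "p \<in> circle_union I" "e \<in> {1, -1::real}"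
  shows "\<forall>\<^sub>F s in at_right 0. shift p (e * s) \<notin> F"
proof -
  have "\<forall>\<^sub>F s in at_right 0. shift p (e * s) \<noteq> q" for q
  proof (cases "\<exists>u. 0 < u \<and> u < pi \<and> shift p (e * u) = q")
    case True
    then obtain u where u: "0 < u" "u < pi" "shift p (e * u) = q" by blast
    have "shift p (e * s) \<noteq> q" if "0 < s" "s < u" for s
      using that u assms(3) shift_eq_iff[OF assms(2), of "e * s" "e * u"]
        cis_inj[of "e * s" "e * u"] by auto
    then show ?thesis using u(1) unfolding eventually_at_right_field by blast
  next
    case False
    then show ?thesis unfolding eventually_at_right_field using pi_gt_zero by blast
  qed
  then have "\<forall>\<^sub>F s in at_right 0. \<forall>q\<in>F. shift p (e * s) \<noteq> q"
    using assms(1) by (simp add: eventually_ball_finite)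
  then show ?thesis by (rule eventually_mono) blast
qed

text \<open>All that sides and colourings require of a diagram. For the diagram after a move it
  follows from the description of its endpoints alone.\<close>

definition finite_ends :: "gauss \<Rightarrow> bool" where
  "finite_ends G \<longleftrightarrow> finite (endpoints G) \<and> endpoints G \<subseteq> core G"

lemma simple_gauss_finite_ends: "simple_gauss G \<Longrightarrow> finite_ends G"
  by (force simp: simple_gauss_def finite_ends_def endpoints_def intro: card_ge_0_finite)

section \<open>Intervals and the two sides of a point\<close>

lemma interval_of_in_intervals:
  "x \<in> core G - endpoints G \<Longrightarrow> interval_of G x \<in> intervals G"
  by (auto simp: intervals_def interval_of_def intro: componentsI)

lemma in_interval_of: "x \<in> core G - endpoints G \<Longrightarrow> x \<in> interval_of G x"
  by (simp add: interval_of_def)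

lemma intervals_subset: "A \<in> intervals G \<Longrightarrow> A \<subseteq> core G - endpoints G"
  by (simp add: intervals_def in_components_subset)

lemma interval_of_eq: "A \<in> intervals G \<Longrightarrow> x \<in> A \<Longrightarrow> interval_of G x = A"
  unfolding intervals_def interval_of_def
  by (metis componentsE connected_component_eq)

lemma intervals_unique:
  "A \<in> intervals G \<Longrightarrow> B \<in> intervals G \<Longrightarrow> x \<in> A \<Longrightarrow> x \<in> B \<Longrightarrow> A = B"
  using interval_of_eq by blast

lemma connected_subset_interval_of:
  "connected T \<Longrightarrow> T \<subseteq> core G - endpoints G \<Longrightarrow> x \<in> T \<Longrightarrow> T \<subseteq> interval_of G x"
  unfolding interval_of_def by (rule connected_component_maximal)

lemma interval_nonempty: "A \<in> intervals G \<Longrightarrow> \<exists>x. x \<in> A"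
  using in_components_nonempty unfolding intervals_def by blast

lemma interval_connected: "A \<in> intervals G \<Longrightarrow> connected A"
  unfolding intervals_def by (rule in_components_connected)

lemma side_eqI:
  assumes "A \<in> intervals G" "\<forall>\<^sub>F s in at_right 0. shift p (e * s) \<in> A"
  shows "side G p e = A"
  unfolding side_def
proof (rule the_equality)
  fix B assume B: "B \<in> intervals G \<and> (\<forall>\<^sub>F s in at_right 0. shift p (e * s) \<in> B)"
  then have "\<forall>\<^sub>F s in at_right 0. shift p (e * s) \<in> A \<and> shift p (e * s) \<in> B"
    using assms(2) by (simp add: eventually_conj)
  then obtain s where "shift p (e * s) \<in> A" "shift p (e * s) \<in> B"
    using eventually_happens'[OF trivial_limit_at_right_real] by blast
  then show "B = A" using intervals_unique B assms(1) by blast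
qed (use assms in blast)

text \<open>Justifies the definite description in \<open>side\<close>: as endpoints are finite in
  number, a short open arc next to \<open>p\<close> avoids them, and being connected it lies in a
  single interval.\<close>

lemma side_spec:
  assumes "finite_ends G" "p \<in> core G" "e \<in> {1, -1}"
  shows "side G p e \<in> intervals G" "\<forall>\<^sub>F s in at_right 0. shift p (e * s) \<in> side G p e"
proof -
  have "\<forall>\<^sub>F s in at_right 0. shift p (e * s) \<notin> endpoints G"
    using assms eventually_shift_notin finite_ends_def by blast
  then obtain d where d: "d > 0" "\<And>s. 0 < s \<Longrightarrow> s < d \<Longrightarrow> shift p (e * s) \<notin> endpoints G"
    unfolding eventually_at_right_field by blast
  define T where "T = (\<lambda>s. shift p (e * s)) ` {0<..<d}"
  have "continuous_on {0<..<d} (\<lambda>s. shift p (e * s))"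
    using continuous_on_compose2[OF continuous_on_shift[of UNIV p], of _ "\<lambda>s. e * s"]
    by (auto intro: continuous_intros)
  then have "connected T"
    unfolding T_def by (rule connected_continuous_image) simp
  moreover have sub: "T \<subseteq> core G - endpoints G"
    using d(2) assms(2) by (auto simp: T_def)
  moreover have x: "shift p (e * (d/2)) \<in> T"
    using d(1) unfolding T_def by (intro imageI) auto
  ultimately have "T \<subseteq> interval_of G (shift p (e * (d/2)))"
    by (rule connected_subset_interval_of)
  then have ev: "\<forall>\<^sub>F s in at_right 0. shift p (e * s) \<in> interval_of G (shift p (e * (d/2)))"
    unfolding eventually_at_right_field T_def using d(1) by fastforce
  have int: "interval_of G (shift p (e * (d/2))) \<in> intervals G"
    using x sub interval_of_in_intervals by blast
  then have "side G p e = interval_of G (shift p (e * (d/2)))"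
    using ev by (rule side_eqI)
  with ev int show "side G p e \<in> intervals G"
    "\<forall>\<^sub>F s in at_right 0. shift p (e * s) \<in> side G p e"
    by simp_all
qed

lemma eventually_interval_of_shift:
  assumes "finite_ends G" "p \<in> core G" "e \<in> {1, -1}"
  shows "\<forall>\<^sub>F s in at_right 0. interval_of G (shift p (e * s)) = side G p e"
  using side_spec(2)[OF assms] by (rule eventually_mono) (use interval_of_eq side_spec(1)[OF assms] in blast)

lemma side_interior:
  assumes "finite_ends G" "x \<in> core G - endpoints G" "e \<in> {1, -1}"
  shows "side G x e = interval_of G x"
proof (rule side_eqI)
  have "\<forall>\<^sub>F s in at_right 0. shift x (e * s) \<notin> endpoints G"
    using assms eventually_shift_notin finite_ends_def by blast
  then obtain d where d: "d > 0" "\<And>s. 0 < s \<Longrightarrow> s < d \<Longrightarrow> shift x (e * s) \<notin> endpoints G"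
    unfolding eventually_at_right_field by blast
  \<comment> \<open>The arc includes \<open>x\<close> itself (angle 0), which ties it to the
    component of \<open>x\<close>.\<close>
  define T where "T = (\<lambda>s. shift x (e * s)) ` {0..<d}"
  have "continuous_on {0..<d} (\<lambda>s. shift x (e * s))"
    using continuous_on_compose2[OF continuous_on_shift[of UNIV x], of _ "\<lambda>s. e * s"]
    by (auto intro: continuous_intros)
  then have "connected T"
    unfolding T_def by (rule connected_continuous_image) simp
  moreover have "shift x (e * s) \<notin> endpoints G" if "0 \<le> s" "s < d" for s
    using d(2)[of s] that assms(2) by (cases "s = 0") auto
  then have "T \<subseteq> core G - endpoints G"
    using assms(2) by (auto simp: T_def)
  moreover have "x \<in> T"
    using d(1) unfolding T_def by (auto intro!: image_eqI[where x = 0])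
  ultimately have "T \<subseteq> interval_of G x"
    by (rule connected_subset_interval_of)
  then show "\<forall>\<^sub>F s in at_right 0. shift x (e * s) \<in> interval_of G x"
    unfolding eventually_at_right_field T_def using d(1) by fastforce
qed (use assms interval_of_in_intervals in blast)

text \<open>The circle indices form a discrete space, so the first projection is locally constant on
  a connected set.\<close>

lemma interval_fst_eq:
  assumes "A \<in> intervals G" "x \<in> A" "y \<in> A"
  shows "fst x = fst y"
proof -
  have "connected (fst ` A)"
    by (intro connected_continuous_image continuous_on_fst continuous_on_id interval_connected[OF assms(1)])
  then show ?thesis
    using assms(2,3) connected_local_const[of "fst ` A" "fst x" "fst y" id]
    by (simp add: at_discrete)
qed

lemma side_fst:
  assumes "finite_ends G" "p \<in> core G" "e \<in> {1, -1}" "x \<in> side G p e"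
  shows "fst x = fst p"
proof -
  obtain s where "shift p (e * s) \<in> side G p e"
    using eventually_happens'[OF trivial_limit_at_right_real side_spec(2)[OF assms(1-3)]] by blast
  then show ?thesis
    using interval_fst_eq[OF side_spec(1)[OF assms(1-3)] assms(4)] fst_shift by metis
qed

lemma circle_point_shift:
  assumes "p \<in> circle_union I" "q \<in> circle_union I" "fst p = fst q"
  shows "\<exists>t. 0 \<le> t \<and> t < 2 * pi \<and> q = shift p t"
proof -
  have n: "norm (snd q / snd p) = 1" and "snd p \<noteq> 0"
    using assms by (auto simp: circle_union_def norm_divide)
  have "cis (Arg2pi (snd q / snd p)) = snd q / snd p"
    using n complex_norm_eq_1_exp cis_conv_exp by metis
  then have "q = shift p (Arg2pi (snd q / snd p))"
    using assms(3) \<open>snd p \<noteq> 0\<close> by (simp add: shift_def prod_eq_iff)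
  then show ?thesis using Arg2pi_ge_0 Arg2pi_lt_2pi by blast
qed

lemma circle_point_shift_signed:
  assumes "p \<in> circle_union I" "q \<in> circle_union I" "fst p = fst q" "p \<noteq> q" "e \<in> {1, -1}"
  shows "\<exists>t. 0 < t \<and> t < 2 * pi \<and> q = shift p (e * t)"
proof -
  obtain t where t: "0 \<le> t" "t < 2 * pi" "q = shift p t"
    using circle_point_shift[OF assms(1-3)] by blast
  have "t \<noteq> 0" using t(3) assms(4) by auto
  \<comment> \<open>The same point is reached clockwise through the complementary angle.\<close>
  moreover have "q = shift p (- (2 * pi - t))"
    using t(3) shift_eq_iff[OF assms(1), of t "- (2 * pi - t)"] cis_divide[of t "2 * pi"] by simp
  ultimately show ?thesis
    using t assms(5) by (cases "e = 1") (metis mult_1 less_eq_real_def,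
      auto intro: exI[of _ "2 * pi - t"])
qed

text \<open>If an interval started at two points, the two closed arcs between them would disconnect it.\<close>

lemma side_inj:
  assumes G: "finite_ends G" and p: "p \<in> endpoints G" and q: "q \<in> endpoints G" and e: "e \<in> {1, -1}"
    and eq: "side G p e = side G q e"
  shows "p = q"
proof (rule ccontr)
  assume "p \<noteq> q"
  have core: "p \<in> core G" "q \<in> core G" using G p q by (auto simp: finite_ends_def)
  define A where "A = side G p e"
  have A: "A \<in> intervals G" unfolding A_def using side_spec G core e by blast
  have evp: "\<forall>\<^sub>F s in at_right 0. shift p (e * s) \<in> A"
    unfolding A_def using side_spec G core e by blast
  have evq: "\<forall>\<^sub>F s in at_right 0. shift q (e * s) \<in> A"
    unfolding A_def eq using side_spec G core e by blast
  have fstA: "fst x = fst p" if "x \<in> A" for x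
    using side_fst G core e that unfolding A_def by blast
  have "fst p = fst q"
    using fstA eventually_happens'[OF trivial_limit_at_right_real evq] fst_shift by metis
  then obtain T where T: "0 < T" "T < 2 * pi" "q = shift p (e * T)"
    using circle_point_shift_signed[OF core(1,2) _ \<open>p \<noteq> q\<close> e] by blast
  define h where "h = (\<lambda>s. shift p (e * s))"
  have h: "continuous_on S h" for S
    unfolding h_def using continuous_on_compose2[OF continuous_on_shift[of UNIV p], of _ "\<lambda>s. e * s"]
    by (auto intro: continuous_intros)
  have closed: "closed (h ` {a..b})" for a b
    using compact_continuous_image[OF h compact_Icc] compact_imp_closed by blast
  have cover: "A \<subseteq> h ` {0..T} \<union> h ` {T..2*pi}"
  proof
    fix x assume x: "x \<in> A"
    have "x \<noteq> p" "x \<in> core G" using intervals_subset[OF A] x p by auto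
    then obtain t where t: "0 < t" "t < 2 * pi" "x = shift p (e * t)"
      using circle_point_shift_signed[OF core(1) _ _ _ e] fstA[OF x] by metis
    then show "x \<in> h ` {0..T} \<union> h ` {T..2*pi}"
      by (cases "t \<le> T") (auto simp: h_def)
  qed
  have "h ` {0..T} \<inter> h ` {T..2*pi} \<subseteq> {p, q}"
  proof
    fix x assume "x \<in> h ` {0..T} \<inter> h ` {T..2*pi}"
    then obtain t u where tu: "t \<in> {0..T}" "u \<in> {T..2*pi}" "h t = h u" "x = h t"
      by blast
    have "cis (e * t) = cis (e * u)"
      using tu(3) shift_eq_iff[OF core(1)] by (simp add: h_def)
    moreover have "\<bar>e * t - e * u\<bar> = u - t" using e tu T by auto
    ultimately have "t = u" if "u - t < 2 * pi"
      using cis_inj[of "e * t" "e * u"] that e by auto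
    \<comment> \<open>Here \<open>u - t\<close> is at most \<open>2 * pi\<close>, with equality only
      for \<open>t = 0\<close> and \<open>u = 2 * pi\<close>, when both angles give
      \<open>p\<close>. Otherwise \<open>t = u\<close>, which forces both to be \<open>T\<close>,
      the angle of \<open>q\<close>.\<close>
    then have "t = T \<or> t = 0" using tu(1,2) T by force
    then show "x \<in> {p, q}" using tu(4) T(3) by (auto simp: h_def)
  qed
  then have disj: "h ` {0..T} \<inter> h ` {T..2*pi} \<inter> A = {}"
    using intervals_subset[OF A] p q by blast
  \<comment> \<open>With \<open>s\<close> below both bounds, the point just after \<open>p\<close>
    stays on the first arc and the point just after \<open>q\<close> on the second, so the interval
    meets both.\<close>
  have "\<forall>\<^sub>F s in at_right 0. s < T" "\<forall>\<^sub>F s in at_right 0. s < 2 * pi - T"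
    using T by (auto intro!: order_tendstoD(2)[OF tendsto_ident_at])
  then have "\<forall>\<^sub>F s in at_right 0. 0 < s \<and> s < T \<and> s < 2 * pi - T \<and>
      shift p (e * s) \<in> A \<and> shift q (e * s) \<in> A"
    using evp evq eventually_at_right_less[of "0::real"] by (intro eventually_conj)
  then obtain s where s: "0 < s" "s < T" "s < 2 * pi - T" "shift p (e * s) \<in> A" "shift q (e * s) \<in> A"
    using eventually_happens'[OF trivial_limit_at_right_real] by blast
  have "shift q (e * s) = h (T + s)"
    by (simp add: h_def T(3) shift_shift algebra_simps)
  then have "h (T + s) \<in> A" "h s \<in> A" using s by (auto simp: h_def)
  moreover have "h s \<in> h ` {0..T}" "h (T + s) \<in> h ` {T..2*pi}"
    using s by auto
  ultimately have "h ` {0..T} \<inter> A \<noteq> {}" "h ` {T..2*pi} \<inter> A \<noteq> {}"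
    by blast+
  then show False
    using interval_connected[OF A] closed[of 0 T] closed[of T "2 * pi"] cover disj
    unfolding connected_closed by metis
qed

section \<open>Point functions with prescribed jumps\<close>

text \<open>The Boolean \<open>b\<close> is the value just clockwise of \<open>p\<close>, and
  \<open>b \<noteq> (p \<in> J)\<close> is a sum modulo 2, so \<open>J\<close> is the flip set. The
  value \<open>f p\<close> is left out on purpose: at an endpoint a colouring has none.\<close>

definition jumps :: "nat set \<Rightarrow> point set \<Rightarrow> (point \<Rightarrow> bool) \<Rightarrow> bool" where
  "jumps I J f \<longleftrightarrow> (\<forall>p\<in>circle_union I. \<exists>b.
     (\<forall>\<^sub>F s in at_right 0. f (shift p s) = (b \<noteq> (p \<in> J))) \<and> (\<forall>\<^sub>F s in at_right 0. f (shift p (- s)) = b))"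

lemma jumpsE:
  assumes "jumps I J f" "p \<in> circle_union I"
  obtains b d where "d > 0" "\<And>s. 0 < s \<Longrightarrow> s < d \<Longrightarrow> f (shift p s) = (b \<noteq> (p \<in> J))"
    "\<And>s. 0 < s \<Longrightarrow> s < d \<Longrightarrow> f (shift p (- s)) = b"
proof -
  obtain b where b: "\<forall>\<^sub>F s in at_right 0. f (shift p s) = (b \<noteq> (p \<in> J))"
    "\<forall>\<^sub>F s in at_right 0. f (shift p (- s)) = b"
    using assms unfolding jumps_def by blast
  then obtain d1 d2 where "d1 > 0" "\<And>s. 0 < s \<Longrightarrow> s < d1 \<Longrightarrow> f (shift p s) = (b \<noteq> (p \<in> J))"
    "d2 > 0" "\<And>s. 0 < s \<Longrightarrow> s < d2 \<Longrightarrow> f (shift p (- s)) = b"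
    unfolding eventually_at_right_field by blast
  then show thesis using that[of "min d1 d2" b] by simp
qed

lemma jumpsI:
  assumes "\<And>p. p \<in> circle_union I \<Longrightarrow> \<exists>b. (\<forall>\<^sub>F s in at_right 0. f (shift p s) = (b \<noteq> (p \<in> J))) \<and>
    (\<forall>\<^sub>F s in at_right 0. f (shift p (- s)) = b)"
  shows "jumps I J f"
  using assms unfolding jumps_def by blast

text \<open>One-sided limits do not see a finite set of points.\<close>

lemma jumps_cong:
  assumes "jumps I J f" "finite F" "\<And>x. x \<in> circle_union I - F \<Longrightarrow> f x = g x"
  shows "jumps I J g"
proof (rule jumpsI)
  fix p assume p: "p \<in> circle_union I"
  have "\<forall>\<^sub>F s in at_right 0. shift p s \<notin> F" "\<forall>\<^sub>F s in at_right 0. shift p (- s) \<notin> F"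
    using eventually_shift_notin[OF assms(2) p, of 1] eventually_shift_notin[OF assms(2) p, of "-1"] by simp_all
  then have "\<forall>\<^sub>F s in at_right 0. f (shift p s) = g (shift p s)"
    "\<forall>\<^sub>F s in at_right 0. f (shift p (- s)) = g (shift p (- s))"
    using assms(3) p by (simp_all add: eventually_mono)
  note fg = this
  obtain b where b: "\<forall>\<^sub>F s in at_right 0. f (shift p s) = (b \<noteq> (p \<in> J))"
    "\<forall>\<^sub>F s in at_right 0. f (shift p (- s)) = b"
    using assms(1) p unfolding jumps_def by blast
  have "\<forall>\<^sub>F s in at_right 0. g (shift p s) = (b \<noteq> (p \<in> J))"
    using fg(1) b(1) by eventually_elim simp
  moreover have "\<forall>\<^sub>F s in at_right 0. g (shift p (- s)) = b"
    using fg(2) b(2) by eventually_elim simp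
  ultimately show "\<exists>b. (\<forall>\<^sub>F s in at_right 0. g (shift p s) = (b \<noteq> (p \<in> J))) \<and>
      (\<forall>\<^sub>F s in at_right 0. g (shift p (- s)) = b)"
    by blast
qed

text \<open>One-sided limits add modulo 2, hence so do the flips, and sets added modulo 2 give the
  symmetric difference.\<close>

lemma jumps_xor:
  assumes "jumps I J f" "jumps I K g"
  shows "jumps I ((J - K) \<union> (K - J)) (\<lambda>x. f x \<noteq> g x)"
proof (rule jumpsI)
  fix p assume p: "p \<in> circle_union I"
  obtain b where b: "\<forall>\<^sub>F s in at_right 0. f (shift p s) = (b \<noteq> (p \<in> J))"
    "\<forall>\<^sub>F s in at_right 0. f (shift p (- s)) = b"
    using assms(1) p unfolding jumps_def by blast
  obtain c where c: "\<forall>\<^sub>F s in at_right 0. g (shift p s) = (c \<noteq> (p \<in> K))"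
    "\<forall>\<^sub>F s in at_right 0. g (shift p (- s)) = c"
    using assms(2) p unfolding jumps_def by blast
  have "\<forall>\<^sub>F s in at_right 0. (f (shift p s) \<noteq> g (shift p s)) = ((b \<noteq> c) \<noteq> (p \<in> (J - K) \<union> (K - J)))"
    using b(1) c(1) by eventually_elim auto
  moreover have "\<forall>\<^sub>F s in at_right 0. (f (shift p (- s)) \<noteq> g (shift p (- s))) = (b \<noteq> c)"
    using b(2) c(2) by eventually_elim auto
  ultimately show "\<exists>b. (\<forall>\<^sub>F s in at_right 0. (f (shift p s) \<noteq> g (shift p s)) = (b \<noteq> (p \<in> (J - K) \<union> (K - J)))) \<and>
      (\<forall>\<^sub>F s in at_right 0. (f (shift p (- s)) \<noteq> g (shift p (- s))) = b)"
    by blast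
qed

text \<open>The value on a small arc just after \<open>p\<close>. It removes the values that a function takes
  at isolated points, such as the endpoints deleted by a move.\<close>

definition germ :: "(point \<Rightarrow> bool) \<Rightarrow> point \<Rightarrow> bool" where
  "germ f p \<longleftrightarrow> (\<forall>\<^sub>F s in at_right 0. f (shift p s))"

text \<open>By definition a false germ means only "not eventually true". When \<open>f\<close> is
  eventually false this holds because the filter is nontrivial.\<close>

lemma germ_eqI:
  assumes "\<forall>\<^sub>F s in at_right 0. f (shift p s) = c"
  shows "germ f p = c"
proof (cases c)
  case False
  then have "\<not> (\<forall>\<^sub>F s in at_right 0. f (shift p s))" if "\<forall>\<^sub>F s in at_right 0. \<not> f (shift p s)"
    using eventually_happens'[OF trivial_limit_at_right_real eventually_conj[OF that]] by blast
  then show ?thesis using assms False by (simp add: germ_def)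
qed (use assms in \<open>simp add: germ_def\<close>)

lemma germ_arc:
  assumes "\<And>s. a < s \<Longrightarrow> s < b \<Longrightarrow> f (shift p s) = c" "a < s" "s < b"
  shows "germ f (shift p s) = c"
proof (rule germ_eqI)
  have "f (shift (shift p s) t) = c" if "0 < t" "t < b - s" for t
    using assms(1)[of "s + t"] assms(2) that by (simp add: shift_shift)
  then show "\<forall>\<^sub>F t in at_right 0. f (shift (shift p s) t) = c"
    unfolding eventually_at_right_field using assms(3) by (intro exI[of _ "b - s"]) auto
qed

lemma germ_arc_neg:
  assumes "\<And>s. 0 < s \<Longrightarrow> s < d \<Longrightarrow> f (shift p (- s)) = c" "0 < s" "s < d"
  shows "germ f (shift p (- s)) = c"
proof (rule germ_arc)
  show "f (shift p t) = c" if "- d < t" "t < 0" for t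
    using assms(1)[of "- t"] that by simp
qed (use assms(2,3) in auto)

lemma jumps_germ:
  assumes "jumps I J f"
  shows "jumps I J (germ f)"
proof (rule jumpsI)
  fix p assume "p \<in> circle_union I"
  then obtain b d where d: "d > 0" "\<And>s. 0 < s \<Longrightarrow> s < d \<Longrightarrow> f (shift p s) = (b \<noteq> (p \<in> J))"
    "\<And>s. 0 < s \<Longrightarrow> s < d \<Longrightarrow> f (shift p (- s)) = b"
    using jumpsE[OF assms] by metis
  have "germ f (shift p s) = (b \<noteq> (p \<in> J))" "germ f (shift p (- s)) = b" if "0 < s" "s < d" for s
    using germ_arc[of 0 d f p, OF d(2) that] germ_arc_neg[of d f p, OF d(3) that] by blast+
  then show "\<exists>b. (\<forall>\<^sub>F s in at_right 0. germ f (shift p s) = (b \<noteq> (p \<in> J))) \<and>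
      (\<forall>\<^sub>F s in at_right 0. germ f (shift p (- s)) = b)"
    unfolding eventually_at_right_field using d(1) by blast
qed

text \<open>Without a flip at \<open>a\<close> the two one-sided limits agree, and
  \<open>germ\<close> also fills in this common value at \<open>a\<close> itself, where
  \<open>f\<close> may deviate.\<close>

lemma germ_locally_constant:
  assumes "jumps I J f" "a \<in> circle_union I - J"
  shows "\<exists>d>0. \<forall>t. \<bar>t\<bar> < d \<longrightarrow> germ f (shift a t) = germ f a"
proof -
  obtain b d where d: "d > 0" "\<And>s. 0 < s \<Longrightarrow> s < d \<Longrightarrow> f (shift a s) = b"
    "\<And>s. 0 < s \<Longrightarrow> s < d \<Longrightarrow> f (shift a (- s)) = b"
  proof (rule jumpsE[OF assms(1), of a])
    fix b d assume bd: "d > 0" "\<And>s. 0 < s \<Longrightarrow> s < d \<Longrightarrow> f (shift a s) = (b \<noteq> (a \<in> J))"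
      "\<And>s. 0 < s \<Longrightarrow> s < d \<Longrightarrow> f (shift a (- s)) = b"
    show thesis by (rule that[of d b]) (use bd assms(2) in auto)
  qed (use assms(2) in simp)
  have "germ f a = b"
    using d(1,2) by (intro germ_eqI) (auto simp: eventually_at_right_field)
  moreover have "germ f (shift a t) = b" if "\<bar>t\<bar> < d" "t \<noteq> 0" for t
    using germ_arc[of 0 d f a b t, OF d(2)] germ_arc_neg[of d f a b "- t", OF d(3)] that
    by (cases "t > 0") simp_all
  ultimately have "\<forall>t. \<bar>t\<bar> < d \<longrightarrow> germ f (shift a t) = germ f a"
    by (metis shift_0)
  then show ?thesis using d(1) by blast
qed

text \<open>Passes from topological neighbourhoods to small angles: discreteness of the indices
  keeps \<open>y\<close> on the circle of \<open>a\<close>, and \<open>Arg\<close> is continuous at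
  1, the limit of the quotient.\<close>

lemma eventually_near_shift:
  assumes "a \<in> circle_union I" "0 < d"
  shows "\<forall>\<^sub>F y in at a within circle_union I. \<exists>t. \<bar>t\<bar> < d \<and> y = shift a t"
proof -
  have nz: "snd a \<noteq> 0" using assms(1) by (auto simp: circle_union_def)
  have id: "((\<lambda>y. y) \<longlongrightarrow> a) (at a within circle_union I)" by (rule tendsto_ident_at)
  have "((\<lambda>y. snd y / snd a) \<longlongrightarrow> snd a / snd a) (at a within circle_union I)"
    using nz by (intro tendsto_intros id)
  then have "((\<lambda>y. Arg (snd y / snd a)) \<longlongrightarrow> Arg (snd a / snd a)) (at a within circle_union I)"
    using nz by (intro isCont_tendsto_compose[OF continuous_at_Arg]) auto
  then have "\<forall>\<^sub>F y in at a within circle_union I. \<bar>Arg (snd y / snd a)\<bar> < d"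
    using assms(2) nz tendstoD[of "\<lambda>y. Arg (snd y / snd a)" 0] by (force simp: dist_real_def)
  moreover have "\<forall>\<^sub>F y in at a within circle_union I. fst y = fst a"
    using topological_tendstoD[OF tendsto_fst[OF id], of "{fst a}"] by (simp add: open_discrete)
  moreover have "\<forall>\<^sub>F y in at a within circle_union I. y \<in> circle_union I"
    by (simp add: eventually_at_filter)
  ultimately show ?thesis
  proof eventually_elim
    case (elim y)
    have "norm (snd y / snd a) = 1"
      using assms(1) elim(3) by (auto simp: circle_union_def norm_divide)
    then have "cis (Arg (snd y / snd a)) = snd y / snd a"
      using cis_Arg[of "snd y / snd a"] by (cases "snd y / snd a = 0") (simp_all add: sgn_div_norm)
    then have "y = shift a (Arg (snd y / snd a))"
      using elim(2) nz by (simp add: shift_def prod_eq_iff)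
    then show ?case using elim(1) by blast
  qed
qed

text \<open>Used with an interval for \<open>S\<close> to read off the colour of that interval, and
  with a whole circle when there are no flips at all.\<close>

lemma germ_constant:
  assumes "jumps I J f" "connected S" "S \<subseteq> circle_union I - J" "x \<in> S" "y \<in> S"
  shows "germ f x = germ f y"
proof (rule connected_local_const[OF assms(2,4,5)], rule ballI)
  fix a assume a: "a \<in> S"
  then obtain d where d: "d > 0" "\<And>t. \<bar>t\<bar> < d \<Longrightarrow> germ f (shift a t) = germ f a"
    using germ_locally_constant[OF assms(1)] assms(3) by blast
  have "\<forall>\<^sub>F y in at a within S. \<exists>t. \<bar>t\<bar> < d \<and> y = shift a t"
    using eventually_near_shift[of a I d] a assms(3) d(1) at_le[of S "circle_union I" a]
    by (auto simp: le_filter_def)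
  then show "\<forall>\<^sub>F y in at a within S. germ f a = germ f y"
    by (rule eventually_mono) (use d(2) in auto)
qed

lemma connected_circle: "connected ({i} \<times> sphere (0::complex) 1)"
  by (intro connected_Times connected_sphere) auto

section \<open>Colourings as functions with jumps\<close>

lemma eventually_colour:
  assumes "finite_ends G" "p \<in> core G"
  shows "\<forall>\<^sub>F s in at_right 0. C (interval_of G (shift p s)) = C (side G p 1)"
    and "\<forall>\<^sub>F s in at_right 0. C (interval_of G (shift p (- s))) = C (side G p (-1))"
  using eventually_interval_of_shift[OF assms, of 1] eventually_interval_of_shift[OF assms, of "-1"]
  by (auto elim: eventually_mono)

text \<open>At an endpoint the one-sided limits are the colours of its two sides. At any other point
  both sides are the interval containing it, so no flip can occur there.\<close>

lemma two_colouring_iff_jumps: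
  assumes "finite_ends G"
  shows "two_colouring G C \<longleftrightarrow> jumps (circles G) (endpoints G) (\<lambda>x. C (interval_of G x))"
proof
  assume C: "two_colouring G C"
  show "jumps (circles G) (endpoints G) (\<lambda>x. C (interval_of G x))"
  proof (rule jumpsI)
    fix p assume p: "p \<in> core G"
    have eq: "C (side G p 1) = (C (side G p (-1)) \<noteq> (p \<in> endpoints G))"
      using C side_interior[OF assms, of p] p unfolding two_colouring_def
      by (cases "p \<in> endpoints G") auto
    then show "\<exists>b. (\<forall>\<^sub>F s in at_right 0. C (interval_of G (shift p s)) = (b \<noteq> (p \<in> endpoints G))) \<and>
        (\<forall>\<^sub>F s in at_right 0. C (interval_of G (shift p (- s))) = b)"
      using eventually_colour[OF assms p, of C] unfolding eq by blast
  qed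
next
  assume J: "jumps (circles G) (endpoints G) (\<lambda>x. C (interval_of G x))"
  show "two_colouring G C"
    unfolding two_colouring_def
  proof
    fix p assume pE: "p \<in> endpoints G"
    then have p: "p \<in> core G" using assms by (auto simp: finite_ends_def)
    obtain b where b: "\<forall>\<^sub>F s in at_right 0. C (interval_of G (shift p s)) = (\<not> b)"
        "\<forall>\<^sub>F s in at_right 0. C (interval_of G (shift p (- s))) = b"
      using J p pE unfolding jumps_def by auto
    \<comment> \<open>The claim does not mention \<open>s\<close>, so it holds outright once it
      holds eventually along a nontrivial filter.\<close>
    have "\<forall>\<^sub>F s::real in at_right 0. C (side G p 1) \<noteq> C (side G p (-1))"
      using b eventually_colour[OF assms p, of C] by eventually_elim auto
    then show "C (side G p 1) \<noteq> C (side G p (-1))"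
      by simp
  qed
qed

text \<open>The germ is constant on each interval, so testing it at some point of the interval gives
  a well-defined colour. The result refers to \<open>germ f\<close> and not to \<open>f\<close>,
  since \<open>f\<close> may be wrong at isolated points inside an interval.\<close>

lemma colouring_from_jumps:
  assumes G: "finite_ends G" and f: "jumps (circles G) (endpoints G) f"
  shows "\<exists>C. two_colouring G C \<and> (\<forall>x\<in>core G - endpoints G. C (interval_of G x) = germ f x)"
proof -
  define C where "C A = (\<exists>x\<in>A. germ f x)" for A
  have C: "C (interval_of G x) = germ f x" if x: "x \<in> core G - endpoints G" for x
  proof -
    have A: "interval_of G x \<in> intervals G" and xA: "x \<in> interval_of G x"
      using x interval_of_in_intervals in_interval_of by blast+
    have "germ f y = germ f x" if "y \<in> interval_of G x" for y
      using germ_constant[OF f interval_connected[OF A] intervals_subset[OF A] that xA] .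
    then show ?thesis unfolding C_def using xA by blast
  qed
  have "two_colouring G C"
    unfolding two_colouring_iff_jumps[OF G]
    by (rule jumps_cong[OF jumps_germ[OF f], of "endpoints G"])
      (use G C in \<open>auto simp: finite_ends_def\<close>)
  then show ?thesis using C by blast
qed

lemma germ_colour:
  assumes "finite_ends G" "x \<in> core G - endpoints G"
  shows "\<forall>\<^sub>F s in at_right 0. C (interval_of G (shift x s)) = C (interval_of G x)"
  using eventually_colour(1)[OF assms(1), of x C] side_interior[OF assms, of 1] assms(2) by simp

text \<open>Satisfied by a union \<open>R\<close> of disjoint closed proper arcs with set of end points \<open>P\<close>.\<close>

definition region :: "nat set \<Rightarrow> point set \<Rightarrow> point set \<Rightarrow> bool" where
  "region I P R \<longleftrightarrow> P \<subseteq> circle_union I \<and> P \<subseteq> R \<and> jumps I P (\<lambda>x. x \<in> R) \<and>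
     (\<forall>x\<in>circle_union I - P. \<forall>e\<in>{1,-1}. \<forall>\<^sub>F s in at_right 0. shift x (e * s) \<in> R \<longleftrightarrow> x \<in> R) \<and>
     (\<forall>x\<in>R. \<exists>p\<in>P. fst p = fst x)"

text \<open>Disjointness makes the indicator of the union the sum modulo 2 of the two indicators,
  and keeps ends of one part from cancelling ends of the other.\<close>

lemma region_Un:
  assumes "region I P R" "region I Q S" "R \<inter> S = {}"
  shows "region I (P \<union> Q) (R \<union> S)"
proof -
  have sub: "P \<subseteq> circle_union I" "P \<subseteq> R" "Q \<subseteq> circle_union I" "Q \<subseteq> S"
    using assms unfolding region_def by blast+
  have "jumps I ((P - Q) \<union> (Q - P)) (\<lambda>x. (x \<in> R) \<noteq> (x \<in> S))"
    using assms(1,2) unfolding region_def by (intro jumps_xor) auto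
  moreover have "(P - Q) \<union> (Q - P) = P \<union> Q" using assms(3) sub by blast
  ultimately have "jumps I (P \<union> Q) (\<lambda>x. x \<in> R \<union> S)"
    using jumps_cong[of I "P \<union> Q" "\<lambda>x. (x \<in> R) \<noteq> (x \<in> S)" "{}" "\<lambda>x. x \<in> R \<union> S"] assms(3) by auto
  moreover have "\<forall>\<^sub>F s in at_right 0. shift x (e * s) \<in> R \<union> S \<longleftrightarrow> x \<in> R \<union> S"
    if "x \<in> circle_union I - (P \<union> Q)" "e \<in> {1,-1}" for x e
  proof -
    have "\<forall>\<^sub>F s in at_right 0. shift x (e * s) \<in> R \<longleftrightarrow> x \<in> R" "\<forall>\<^sub>F s in at_right 0. shift x (e * s) \<in> S \<longleftrightarrow> x \<in> S"
      using assms(1,2) that unfolding region_def by blast+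
    then show ?thesis by eventually_elim auto
  qed
  moreover have "\<exists>p\<in>P \<union> Q. fst p = fst x" if "x \<in> R \<union> S" for x
    using that assms(1,2) unfolding region_def by blast
  ultimately show ?thesis using sub unfolding region_def by blast
qed

section \<open>Existence and uniqueness of transported colourings\<close>

lemma transport_exists:
  assumes G: "finite_ends G" and H: "finite_ends H" and I: "circles H = circles G"
    and R: "region (circles G) P R"
    and E: "endpoints H = (endpoints G - P) \<union> (P - endpoints G) \<or> endpoints H = endpoints G"
    and C: "two_colouring G C"
  shows "\<exists>C'. transported R G C H C'"
proof -
  \<comment> \<open>The set to be added and its ends: empty if the endpoints stay the same (move
    III), else the region. The symmetric difference in \<open>EH\<close> covers both the deletion
    and the insertion of \<open>P\<close>.\<close>
  define J where "J = (if endpoints H = endpoints G then {} else P)"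
  define S where "S = (if endpoints H = endpoints G then {} else R)"
  have EH: "endpoints H = (endpoints G - J) \<union> (J - endpoints G)" using E by (auto simp: J_def)
  have "jumps (circles G) {} (\<lambda>x. x \<in> {})" by (auto intro!: jumpsI exI[of _ False])
  then have "jumps (circles G) J (\<lambda>x. x \<in> S)"
    using R by (simp add: region_def J_def S_def)
  then have jf: "jumps (circles H) (endpoints H) (\<lambda>x. C (interval_of G x) \<noteq> (x \<in> S))"
    using jumps_xor C unfolding two_colouring_iff_jumps[OF G] EH I by blast
  obtain C' where C': "two_colouring H C'"
    "\<And>x. x \<in> core H - endpoints H \<Longrightarrow> C' (interval_of H x) = germ (\<lambda>x. C (interval_of G x) \<noteq> (x \<in> S)) x"
    using colouring_from_jumps[OF H jf] by blast
  have "C' (interval_of H x) = C (interval_of G x)"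
    if x: "x \<in> core G - (endpoints G \<union> endpoints H \<union> R)" for x
  proof -
    \<comment> \<open>As \<open>P \<subseteq> R\<close>, a point outside \<open>R\<close> is no end
      of \<open>R\<close>, so \<open>R\<close> is avoided just after it as well.\<close>
    have "\<forall>\<^sub>F s in at_right 0. shift x s \<notin> S"
    proof (cases "endpoints H = endpoints G")
      case False
      have "\<forall>\<^sub>F s in at_right 0. shift x (1 * s) \<in> R \<longleftrightarrow> x \<in> R"
        using R x unfolding region_def by blast
      then show ?thesis using x False by (simp add: S_def)
    qed (simp add: S_def)
    moreover have "\<forall>\<^sub>F s in at_right 0. C (interval_of G (shift x s)) = C (interval_of G x)"
      using germ_colour[OF G, of x C] x by blast
    ultimately have "\<forall>\<^sub>F s in at_right 0.
        (C (interval_of G (shift x s)) \<noteq> (shift x s \<in> S)) = C (interval_of G x)"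
      by eventually_elim simp
    then show ?thesis using C'(2)[of x] x I germ_eqI by auto
  qed
  then show ?thesis unfolding transported_def using C C'(1) by blast
qed

lemma transport_unique:
  assumes G: "finite_ends G" and H: "finite_ends H" and I: "circles H = circles G"
    and R: "region (circles G) P R"
    and C': "transported R G C H C'" and C'': "transported R G C H C''"
    and A: "A \<in> intervals H"
  shows "C'' A = C' A"
proof -
  define d where "d x \<longleftrightarrow> C'' (interval_of H x) \<noteq> C' (interval_of H x)" for x
  have "jumps (circles H) ((endpoints H - endpoints H) \<union> (endpoints H - endpoints H)) d"
    unfolding d_def using C' C'' unfolding transported_def two_colouring_iff_jumps[OF H]
    by (intro jumps_xor) auto
  then have d: "jumps (circles H) {} d" by simp
  have germ_d: "germ d x = d x" if "x \<in> core H - endpoints H" for x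
  proof (rule germ_eqI)
    show "\<forall>\<^sub>F s in at_right 0. d (shift x s) = d x"
      using germ_colour[OF H that, of C'] germ_colour[OF H that, of C'']
      unfolding d_def by eventually_elim simp
  qed
  define F where "F = endpoints G \<union> endpoints H"
  have F: "finite F" using G H by (auto simp: F_def finite_ends_def)
  obtain x where "x \<in> A" using A interval_nonempty by blast
  then have xA: "interval_of H x = A" and x: "x \<in> core H - endpoints H"
    using interval_of_eq[OF A] intervals_subset[OF A] by auto
  \<comment> \<open>A point on the circle of \<open>x\<close> at which both colourings are
    prescribed by \<open>C\<close>. The difference \<open>d\<close> vanishes there, and hence on the
    whole circle.\<close>
  have "\<exists>y\<in>core G. fst y = fst x \<and> y \<notin> F \<union> R"
  proof (cases "\<exists>p\<in>P. fst p = fst x")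
    case True
    then obtain p where p: "p \<in> P" "fst p = fst x" by blast
    then have pc: "p \<in> core G" using R unfolding region_def by blast
    obtain b where "\<forall>\<^sub>F s in at_right 0. (shift p s \<in> R) = (b \<noteq> (p \<in> P))"
      "\<forall>\<^sub>F s in at_right 0. (shift p (- s) \<in> R) = b"
      using R pc unfolding region_def jumps_def by meson
    \<comment> \<open>The indicator of \<open>R\<close> flips at \<open>p\<close>, so one of the two
      sides of \<open>p\<close> lies off \<open>R\<close>.\<close>
    then have "\<exists>e\<in>{1,-1}. \<forall>\<^sub>F s in at_right 0. shift p (e * s) \<notin> R"
      using p(1) by (cases b) simp_all
    then obtain e where e: "e \<in> {1,-1}" "\<forall>\<^sub>F s in at_right 0. shift p (e * s) \<notin> R" by blast
    have "\<forall>\<^sub>F s in at_right 0. shift p (e * s) \<notin> F \<union> R"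
      using eventually_shift_notin[OF F pc e(1)] e(2) by eventually_elim blast
    then obtain s where "shift p (e * s) \<notin> F \<union> R"
      using eventually_happens'[OF trivial_limit_at_right_real] by blast
    then show ?thesis using pc p(2) by (intro bexI[of _ "shift p (e * s)"]) auto
  next
    case False
    have xc: "x \<in> core G" using x I by simp
    have "\<forall>\<^sub>F s in at_right 0. shift x (1 * s) \<notin> F"
      using F xc by (intro eventually_shift_notin) auto
    then obtain s where "shift x (1 * s) \<notin> F"
      using eventually_happens'[OF trivial_limit_at_right_real] by blast
    \<comment> \<open>Each point of \<open>R\<close> shares its circle with a point of
      \<open>P\<close>, so here \<open>R\<close> misses the circle of \<open>x\<close>
      entirely.\<close>
    moreover have "shift x s \<notin> R" using False R unfolding region_def by (metis fst_shift)
    ultimately show ?thesis using xc by (intro bexI[of _ "shift x s"]) auto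
  qed
  then obtain y where y: "y \<in> core G" "fst y = fst x" "y \<notin> F \<union> R" by blast
  then have "\<not> d y"
    using C' C'' unfolding transported_def d_def F_def by auto
  moreover have "{fst x} \<times> sphere 0 1 \<subseteq> core H - {}" "x \<in> {fst x} \<times> sphere 0 1" "y \<in> {fst x} \<times> sphere 0 1"
    using x y(1,2) by (simp_all add: circle_union_def mem_Times_iff subset_iff)
  then have "germ d x = germ d y"
    by (rule germ_constant[OF d connected_circle])
  moreover have "germ d y = d y" "germ d x = d x"
    using germ_d x y I by (auto simp: F_def)
  ultimately show ?thesis by (simp add: d_def xA)
qed

lemma induces_colourings_region:
  assumes "finite_ends G" "finite_ends H" "circles H = circles G" "region (circles G) P R"
    "endpoints H = (endpoints G - P) \<union> (P - endpoints G) \<or> endpoints H = endpoints G"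
  shows "induces_colourings R G H"
  unfolding induces_colourings_def
  using transport_exists[OF assms] transport_unique[OF assms(1-4)] by blast

section \<open>Moves\<close>

text \<open>The sign records which end comes first, so later arguments treat both orders at
  once.\<close>

lemma adjacent_sides:
  assumes "adjacent_via G A p q"
  obtains e where "e \<in> {1, -1}" "side G p e = A" "side G q (- e) = A"
proof -
  have "side G p 1 = A \<and> side G q (-1) = A \<or> side G q 1 = A \<and> side G p (-1) = A"
    using assms by (simp add: adjacent_via_def)
  then show thesis using that[of 1] that[of "-1"] by auto
qed

lemma finite_ends_core: "finite_ends G \<Longrightarrow> p \<in> endpoints G \<Longrightarrow> p \<in> core G"
  by (auto simp: finite_ends_def)

text \<open>By \<open>side_inj\<close> an interval is left in each of the two directions from at
  most one endpoint, and \<open>p\<close> and \<open>q\<close> already account for both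
  directions.\<close>

lemma adjacent_end:
  assumes "finite_ends G" "adjacent_via G A p q" "r \<in> endpoints G" "e \<in> {1, -1}" "side G r e = A"
  shows "r = p \<or> r = q"
proof -
  obtain e' where e': "e' \<in> {1, -1}" "side G p e' = A" "side G q (- e') = A"
    using adjacent_sides[OF assms(2)] by metis
  have pq: "p \<in> endpoints G" "q \<in> endpoints G" using assms(2) by (simp_all add: adjacent_via_def)
  show ?thesis
  proof (cases "e = e'")
    case True
    then have "side G r e = side G p e" using e' assms(5) by simp
    then show ?thesis using side_inj[OF assms(1,3) pq(1) assms(4)] by simp
  next
    case False
    then have "e = - e'" using e'(1) assms(4) by auto
    then have "side G r e = side G q e" using e' assms(5) by simp
    then show ?thesis using side_inj[OF assms(1,3) pq(2) assms(4)] by simp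
  qed
qed

text \<open>If \<open>A\<close> lay on both sides of \<open>p\<close>, then \<open>p\<close> and
  \<open>q\<close> would have it in the same direction, against \<open>side_inj\<close>. This also
  covers a circle whose only endpoints are \<open>p\<close> and \<open>q\<close>.\<close>

lemma adjacent_unique_side:
  assumes "finite_ends G" "adjacent_via G A p q" "r = p \<or> r = q"
  shows "side G r 1 = A \<longleftrightarrow> side G r (-1) \<noteq> A"
proof -
  have pq: "p \<in> endpoints G" "q \<in> endpoints G" "p \<noteq> q" using assms(2) by (simp_all add: adjacent_via_def)
  obtain e where e: "e \<in> {1, -1}" "side G p e = A" "side G q (- e) = A"
    using adjacent_sides[OF assms(2)] by metis
  have "- e \<in> {1, -1}" using e(1) by auto
  then have "side G q e \<noteq> A" "side G p (- e) \<noteq> A"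
    using side_inj[OF assms(1) pq(1,2)] pq(3) e by metis+
  then show ?thesis using assms(3) e by (elim insertE emptyE disjE) simp_all
qed

text \<open>Intervals are disjoint, so close to \<open>x\<close> in direction \<open>e\<close> the
  indicator of the arc only tests whether that side of \<open>x\<close> is \<open>A\<close>. The
  conditions on a region thus become statements about sides.\<close>

lemma region_arc:
  assumes G: "finite_ends G" and A: "adjacent_via G A p q"
  shows "region (circles G) {p, q} (A \<union> {p, q})"
proof -
  have pq: "p \<in> endpoints G" "q \<in> endpoints G" and AI: "A \<in> intervals G"
    using A by (simp_all add: adjacent_via_def)
  have pqc: "p \<in> core G" "q \<in> core G" using finite_ends_core[OF G] pq by blast+
  have ev: "\<forall>\<^sub>F s in at_right 0. (shift x (e * s) \<in> A \<union> {p, q}) = (side G x e = A)"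
    if x: "x \<in> core G" and e: "e \<in> {1, -1}" for x e
  proof -
    have "\<forall>\<^sub>F s in at_right 0. shift x (e * s) \<notin> {p, q}"
      by (rule eventually_shift_notin[OF _ x e]) simp
    then show ?thesis
      using side_spec(2)[OF G x e]
    proof eventually_elim
      case (elim s)
      then have "shift x (e * s) \<in> A \<longleftrightarrow> side G x e = A"
        using intervals_unique[OF AI side_spec(1)[OF G x e]] by blast
      then show ?case using elim(1) by blast
    qed
  qed
  \<comment> \<open>The ends of \<open>A\<close> have it on exactly one side, every other endpoint
    on neither, and a point that is no endpoint has the same interval on both sides.\<close>
  have sides: "(side G x 1 = A) = ((side G x (-1) = A) \<noteq> (x \<in> {p, q}))" if x: "x \<in> core G" for x
  proof (cases "x \<in> {p, q}")
    case True
    then show ?thesis using adjacent_unique_side[OF G A] by blast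
  next
    case False
    then show ?thesis
      using adjacent_end[OF G A, of x] side_interior[OF G, of x] x
      by (cases "x \<in> endpoints G") auto
  qed
  have "jumps (circles G) {p, q} (\<lambda>x. x \<in> A \<union> {p, q})"
  proof (rule jumpsI)
    fix x assume x: "x \<in> core G"
    show "\<exists>b. (\<forall>\<^sub>F s in at_right 0. (shift x s \<in> A \<union> {p, q}) = (b \<noteq> (x \<in> {p, q}))) \<and>
        (\<forall>\<^sub>F s in at_right 0. (shift x (- s) \<in> A \<union> {p, q}) = b)"
      using ev[OF x, of 1] ev[OF x, of "-1"] sides[OF x] by (intro exI[of _ "side G x (-1) = A"]) simp
  qed
  moreover have "\<forall>\<^sub>F s in at_right 0. (shift x (e * s) \<in> A \<union> {p, q}) = (x \<in> A \<union> {p, q})"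
    if x: "x \<in> core G - {p, q}" and e: "e \<in> {1, -1}" for x e
  proof -
    have "(side G x e = A) = (x \<in> A \<union> {p, q})"
    proof (cases "x \<in> endpoints G")
      case True
      then show ?thesis using adjacent_end[OF G A True e] x intervals_subset[OF AI] by auto
    next
      case False
      then show ?thesis
        using side_interior[OF G _ e, of x] interval_of_eq[OF AI, of x] in_interval_of[of x G] x by auto
    qed
    then show ?thesis using ev[OF _ e, of x] x by simp
  qed
  moreover have "\<exists>r\<in>{p, q}. fst r = fst x" if "x \<in> A \<union> {p, q}" for x
  proof (cases "x \<in> A")
    case True
    obtain e where "e \<in> {1, -1}" "side G p e = A" using adjacent_sides[OF A] by metis
    then have "fst x = fst p" using side_fst[OF G pqc(1)] True by blast
    then show ?thesis by simp
  qed (use that in auto)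
  ultimately show ?thesis using pqc unfolding region_def by blast
qed

lemma arcs_disjoint:
  assumes G: "finite_ends G" and A: "adjacent_via G A p q" and B: "adjacent_via G B r s"
    and d: "{p, q} \<inter> {r, s} = {}"
  shows "(A \<union> {p, q}) \<inter> (B \<union> {r, s}) = {}"
proof -
  have AB: "A \<in> intervals G" "B \<in> intervals G" and pq: "{p, q, r, s} \<subseteq> endpoints G"
    using A B by (simp_all add: adjacent_via_def)
  obtain e where e: "e \<in> {1, -1}" "side G r e = B" using adjacent_sides[OF B] by metis
  \<comment> \<open>If \<open>A\<close> and \<open>B\<close> coincided, \<open>r\<close> would be a
    third end of \<open>A\<close>.\<close>
  have "A \<noteq> B" using adjacent_end[OF G A _ e(1), of r] e(2) pq d by auto
  then have "A \<inter> B = {}" using intervals_unique AB by blast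
  then show ?thesis using d pq intervals_subset[OF AB(1)] intervals_subset[OF AB(2)] by blast
qed

section \<open>Colours at adjacent endpoints\<close>

lemma colour_sides_neq:
  assumes "two_colouring G C" "p \<in> endpoints G" "e \<in> {1, -1}"
  shows "C (side G p e) \<noteq> C (side G p (- e))"
  using assms unfolding two_colouring_def by (cases "e = 1") simp_all

lemma adjacent_fst:
  assumes "finite_ends G" "adjacent_via G A p q"
  shows "fst p = fst q"
proof -
  obtain e where e: "e \<in> {1, -1}" "side G p e = A" "side G q (- e) = A"
    using adjacent_sides[OF assms(2)] by metis
  have "A \<in> intervals G" "p \<in> core G" "q \<in> core G"
    using assms(2) finite_ends_core[OF assms(1)] unfolding adjacent_via_def by auto
  moreover obtain x where "x \<in> A" using calculation(1) interval_nonempty by blast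
  ultimately show ?thesis
    using side_fst[OF assms(1), of p e x] side_fst[OF assms(1), of q "- e" x] e by auto
qed

text \<open>Along the common orientation, one of the two endpoints is preceded by \<open>A\<close>.
  The other is followed by \<open>A\<close>, so the interval preceding it has the colour opposite to
  that of \<open>A\<close>.\<close>

lemma adjacent_preceding:
  assumes G: "finite_ends G" and w: "orientation (circles G) w" and C: "two_colouring G C"
    and A: "adjacent_via G A p q"
  shows "C (preceding G w p) \<noteq> C (preceding G w q)"
proof -
  have pq: "p \<in> endpoints G" "q \<in> endpoints G" using A by (simp_all add: adjacent_via_def)
  obtain e where e: "e \<in> {1, -1}" "side G p e = A" "side G q (- e) = A"
    using adjacent_sides[OF A] by metis
  have "fst p \<in> circles G" using finite_ends_core[OF G pq(1)] by (auto simp: circle_union_def)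
  then have "w (fst p) = 1 \<or> w (fst p) = -1" using w by (simp add: orientation_def)
  then have "- w (fst p) = e \<or> - w (fst p) = - e" using e(1) by auto
  then show ?thesis
    using colour_sides_neq[OF C pq(1) e(1)] colour_sides_neq[OF C pq(2) e(1)] e(2,3)
    unfolding preceding_def adjacent_fst[OF G A, symmetric] by auto
qed

lemma chord_parity_pair:
  "chord_parity G w C {p, q} = (if C (preceding G w p) = C (preceding G w q) then 1 else 0)"
  unfolding chord_parity_def by auto

lemma chord_parity_cong:
  assumes "\<And>p. p \<in> c \<Longrightarrow> C (preceding G w p) = C' (preceding G' w p)"
  shows "chord_parity G w C c = chord_parity G' w C' c"
  using assms unfolding chord_parity_def by simp

section \<open>The regions of the three moves\<close>

lemma chords_disjoint:
  "simple_gauss G \<Longrightarrow> c \<in> chords G \<Longrightarrow> d \<in> chords G \<Longrightarrow> p \<in> c \<Longrightarrow> p \<in> d \<Longrightarrow> c = d"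
  unfolding simple_gauss_def pairwise_def disjnt_def by blast

lemma endpoints_remove:
  assumes "simple_gauss G" "S \<subseteq> chords G"
  shows "\<Union> (chords G - S) = endpoints G - \<Union> S"
  unfolding endpoints_def
proof (intro set_eqI iffI)
  fix p assume "p \<in> \<Union> (chords G - S)"
  then show "p \<in> \<Union> (chords G) - \<Union> S"
    using chords_disjoint[OF assms(1)] assms(2) by blast
qed blast

lemma chord_ends_distinct:
  "simple_gauss G \<Longrightarrow> {p, q} \<in> chords G \<Longrightarrow> p \<noteq> q"
  unfolding simple_gauss_def by fastforce

text \<open>What transport and axiom (0) use of a move, in one form for all three: \<open>P\<close>
  collects the end points of the arcs, which are all the endpoints of \<open>G\<close> in
  \<open>R\<close>. The endpoint set either loses \<open>P\<close> (moves I and II) or stays the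
  same (move III).\<close>

definition move_region :: "gauss \<Rightarrow> gauss \<Rightarrow> point set \<Rightarrow> point set \<Rightarrow> bool" where
  "move_region G H P R \<longleftrightarrow> finite_ends G \<and> finite_ends H \<and> circles H = circles G \<and>
     region (circles G) P R \<and> P \<subseteq> endpoints G \<and> R \<inter> endpoints G \<subseteq> P \<and>
     (endpoints H = endpoints G - P \<or> endpoints H = endpoints G) \<and>
     (\<forall>c\<in>chords G \<inter> chords H. c \<inter> P = {})"

lemma move_regionI:
  assumes "simple_gauss G" "circles H = circles G" "region (circles G) P R" "P \<subseteq> endpoints G"
    "R \<inter> endpoints G \<subseteq> P" "endpoints H = endpoints G - P \<or> endpoints H = endpoints G"
    "\<And>c p. c \<in> chords G \<Longrightarrow> c \<in> chords H \<Longrightarrow> p \<in> c \<Longrightarrow> p \<in> P \<Longrightarrow> False"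
  shows "move_region G H P R"
proof -
  have "finite_ends G" using assms(1) simple_gauss_finite_ends by blast
  moreover have "finite_ends H"
    using calculation assms(2,6) unfolding finite_ends_def by auto
  ultimately show ?thesis unfolding move_region_def using assms(2-) by blast
qed

lemma move1_region:
  assumes G: "simple_gauss G" and m: "move1 G c R H"
  shows "\<exists>P. move_region G H P R"
proof -
  obtain p q A where m: "c \<in> chords G" "H = G\<lparr>chords := chords G - {c}\<rparr>" "c = {p, q}"
    "adjacent_via G A p q" "R = A \<union> {p, q}"
    using m unfolding move1_def by blast
  have fe: "finite_ends G" using G by (rule simple_gauss_finite_ends)
  have "A \<inter> endpoints G = {}" using m(4) intervals_subset unfolding adjacent_via_def by blast
  moreover have "region (circles G) c R" using region_arc[OF fe m(4)] m(3,5) by simp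
  moreover have "endpoints H = endpoints G - c"
    using endpoints_remove[OF G, of "{c}"] m(1,2) by (simp add: endpoints_def)
  ultimately have "move_region G H c R"
    using m chords_disjoint[OF G] by (intro move_regionI[OF G]) (auto simp: endpoints_def)
  then show ?thesis by blast
qed

lemma move2_region:
  assumes G: "simple_gauss G" and m: "move2 G c1 c2 R H"
  shows "\<exists>P. move_region G H P R"
proof -
  obtain p1 q1 p2 q2 A B where m: "c1 \<in> chords G" "c2 \<in> chords G" "c1 \<noteq> c2"
    "H = G\<lparr>chords := chords G - {c1, c2}\<rparr>" "c1 = {p1, q1}" "c2 = {p2, q2}"
    "adjacent_via G A p1 p2" "adjacent_via G B q1 q2" "R = A \<union> B \<union> {p1, q1, p2, q2}"
    using m unfolding move2_def by (elim conjE exE) (rule that)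
  have fe: "finite_ends G" using G by (rule simple_gauss_finite_ends)
  have ne: "p1 \<noteq> q1" "p2 \<noteq> q2" using chord_ends_distinct[OF G] m(1,2,5,6) by auto
  have disj: "c1 \<inter> c2 = {}" using chords_disjoint[OF G m(1,2)] m(3) by blast
  have d: "{p1, p2} \<inter> {q1, q2} = {}" using ne disj m(5,6) by auto
  have "(A \<union> B) \<inter> endpoints G = {}"
    using m(7,8) intervals_subset unfolding adjacent_via_def by blast
  \<comment> \<open>The four ends are grouped by arc here, since each arc joins ends of different
    chords. They are regrouped by chord afterwards.\<close>
  moreover have "region (circles G) ({p1, p2} \<union> {q1, q2}) ((A \<union> {p1, p2}) \<union> (B \<union> {q1, q2}))"
    by (intro region_Un region_arc[OF fe] arcs_disjoint[OF fe] m(7,8) d)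
  then have "region (circles G) (c1 \<union> c2) R"
    unfolding m(5,6,9) by (simp add: insert_commute Un_ac)
  moreover have "endpoints H = endpoints G - (c1 \<union> c2)"
    using endpoints_remove[OF G, of "{c1, c2}"] m(1,2,4) by (simp add: endpoints_def)
  moreover have "c1 \<union> c2 \<subseteq> endpoints G" using m(1,2) by (auto simp: endpoints_def)
  moreover have "circles H = circles G" using m(4) by simp
  moreover have "R \<subseteq> A \<union> B \<union> (c1 \<union> c2)" unfolding m(5,6,9) by blast
  moreover have "False" if "c \<in> chords G" "c \<in> chords H" "p \<in> c" "p \<in> c1 \<union> c2" for c p
  proof -
    have "c = c1 \<or> c = c2" using chords_disjoint[OF G that(1)] that(3,4) m(1,2) by blast
    then show False using that(2) m(4) by auto
  qed
  ultimately have "move_region G H (c1 \<union> c2) R"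
    by (intro move_regionI[OF G]) blast+
  then show ?thesis by blast
qed

lemma move3_iff:
  "move3 G (c1, c2, c3) R H (c1', c2', c3') \<longleftrightarrow> (\<exists>a1 a2 b1 b2 d1 d2 A B E.
     {c1, c2, c3} \<subseteq> chords G \<and> c1 \<noteq> c2 \<and> c1 \<noteq> c3 \<and> c2 \<noteq> c3 \<and>
     c1 = {a1, a2} \<and> c2 = {b1, b2} \<and> c3 = {d1, d2} \<and>
     adjacent_via G A a1 b1 \<and> adjacent_via G B a2 d1 \<and> adjacent_via G E b2 d2 \<and>
     c1' = {b1, d1} \<and> c2' = {a1, d2} \<and> c3' = {a2, b2} \<and>
     H = G\<lparr>chords := chords G - {c1, c2, c3} \<union> {c1', c2', c3'}\<rparr> \<and>
     R = A \<union> B \<union> E \<union> {a1, a2, b1, b2, d1, d2})"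
  unfolding move3_def by simp

lemma move3E:
  assumes G: "simple_gauss G" and m: "move3 G (c1, c2, c3) R H (c1', c2', c3')"
  obtains a1 a2 b1 b2 d1 d2 A B E where
    "c1 = {a1, a2}" "c2 = {b1, b2}" "c3 = {d1, d2}"
    "c1' = {b1, d1}" "c2' = {a1, d2}" "c3' = {a2, b2}"
    "c1 \<in> chords G" "c2 \<in> chords G" "c3 \<in> chords G" "distinct [c1, c2, c3]"
    "distinct [a1, a2, b1, b2, d1, d2]"
    "adjacent_via G A a1 b1" "adjacent_via G B a2 d1" "adjacent_via G E b2 d2"
    "circles H = circles G" "chords H = chords G - {c1, c2, c3} \<union> {c1', c2', c3'}"
    "endpoints H = endpoints G"
    "R = A \<union> B \<union> E \<union> {a1, a2, b1, b2, d1, d2}"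
proof -
  obtain a1 a2 b1 b2 d1 d2 A B E where m:
    "c1 = {a1, a2}" "c2 = {b1, b2}" "c3 = {d1, d2}"
    "c1' = {b1, d1}" "c2' = {a1, d2}" "c3' = {a2, b2}"
    "{c1, c2, c3} \<subseteq> chords G" "c1 \<noteq> c2" "c1 \<noteq> c3" "c2 \<noteq> c3"
    "adjacent_via G A a1 b1" "adjacent_via G B a2 d1" "adjacent_via G E b2 d2"
    "H = G\<lparr>chords := chords G - {c1, c2, c3} \<union> {c1', c2', c3'}\<rparr>"
    "R = A \<union> B \<union> E \<union> {a1, a2, b1, b2, d1, d2}"
    using m unfolding move3_iff by (elim conjE exE) (rule that)
  have ne: "a1 \<noteq> a2" "b1 \<noteq> b2" "d1 \<noteq> d2" using chord_ends_distinct[OF G] m(1-3,7) by auto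
  have "c1 \<inter> c2 = {}" "c1 \<inter> c3 = {}" "c2 \<inter> c3 = {}"
    using chords_disjoint[OF G] m(7-10) by blast+
  then have "distinct [a1, a2, b1, b2, d1, d2]" using ne unfolding m(1-3) by auto
  moreover have "\<Union> {c1, c2, c3} = \<Union> {c1', c2', c3'}" unfolding m(1-6) by auto
  then have "endpoints H = endpoints G"
    using endpoints_remove[OF G, of "{c1, c2, c3}"] m(7,14) by (auto simp: endpoints_def)
  ultimately show thesis
    using m by (intro that[of a1 a2 b1 b2 d1 d2 A B E]) simp_all
qed

lemma move3_region:
  assumes G: "simple_gauss G" and m: "move3 G cs R H cs'"
  shows "\<exists>P. move_region G H P R"
proof -
  obtain c1 c2 c3 c1' c2' c3' where "move3 G (c1, c2, c3) R H (c1', c2', c3')"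
    using m by (metis prod_cases3)
  then obtain a1 a2 b1 b2 d1 d2 A B E where m:
    "c1 = {a1, a2}" "c2 = {b1, b2}" "c3 = {d1, d2}"
    "c1' = {b1, d1}" "c2' = {a1, d2}" "c3' = {a2, b2}"
    "c1 \<in> chords G" "c2 \<in> chords G" "c3 \<in> chords G" "distinct [c1, c2, c3]"
    "distinct [a1, a2, b1, b2, d1, d2]"
    "adjacent_via G A a1 b1" "adjacent_via G B a2 d1" "adjacent_via G E b2 d2"
    "circles H = circles G" "chords H = chords G - {c1, c2, c3} \<union> {c1', c2', c3'}"
    "endpoints H = endpoints G"
    "R = A \<union> B \<union> E \<union> {a1, a2, b1, b2, d1, d2}"
    by (rule move3E[OF G])
  have fe: "finite_ends G" using G by (rule simple_gauss_finite_ends)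
  define P where "P = {a1, a2, b1, b2, d1, d2}"
  have P: "P = c1 \<union> c2 \<union> c3" unfolding P_def m(1-3) by blast
  have "(A \<union> {a1, b1}) \<inter> (B \<union> {a2, d1}) = {}"
    by (rule arcs_disjoint[OF fe m(12,13)]) (use m(11) in auto)
  moreover have "(A \<union> {a1, b1}) \<inter> (E \<union> {b2, d2}) = {}"
    by (rule arcs_disjoint[OF fe m(12,14)]) (use m(11) in auto)
  moreover have "(B \<union> {a2, d1}) \<inter> (E \<union> {b2, d2}) = {}"
    by (rule arcs_disjoint[OF fe m(13,14)]) (use m(11) in auto)
  ultimately have "region (circles G) (({a1, b1} \<union> {a2, d1}) \<union> {b2, d2})
      (((A \<union> {a1, b1}) \<union> (B \<union> {a2, d1})) \<union> (E \<union> {b2, d2}))"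
    by (intro region_Un region_arc[OF fe] m(12-14)) blast+
  moreover have "({a1, b1} \<union> {a2, d1}) \<union> {b2, d2} = P" unfolding P_def by blast
  moreover have "((A \<union> {a1, b1}) \<union> (B \<union> {a2, d1})) \<union> (E \<union> {b2, d2}) = R" unfolding m(18) by blast
  ultimately have "region (circles G) P R" by simp
  moreover have "(A \<union> B \<union> E) \<inter> endpoints G = {}"
    using m(12-14) intervals_subset unfolding adjacent_via_def by blast
  then have "R \<inter> endpoints G \<subseteq> P" unfolding m(18) P_def by blast
  moreover have "P \<subseteq> endpoints G" unfolding P using m(7-9) by (auto simp: endpoints_def)
  moreover have False if c: "c \<in> chords G" "c \<in> chords H" "p \<in> c" "p \<in> P" for c p
  proof -
    have "c \<in> {c1, c2, c3}" using chords_disjoint[OF G c(1)] c(3,4) m(7-9) unfolding P by blast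
    \<comment> \<open>Each new chord joins ends of two different old chords, so it is none of the
      old ones.\<close>
    moreover have "c1' \<notin> {c1, c2, c3}" "c2' \<notin> {c1, c2, c3}" "c3' \<notin> {c1, c2, c3}"
      using m(11) unfolding m(1-6) by (auto simp: doubleton_eq_iff)
    ultimately show False using c(2) m(16) by auto
  qed
  ultimately have "move_region G H P R"
    using m(15,17) by (intro move_regionI[OF G]) auto
  then show ?thesis by blast
qed

lemma move_region_exists:
  "simple_gauss G \<Longrightarrow> move R G H \<Longrightarrow> \<exists>P. move_region G H P R"
  unfolding move_def using move1_region move2_region move3_region by blast

text \<open>The same region serves the inverse move: since \<open>P \<subseteq> endpoints G\<close>,
  the symmetric difference with \<open>P\<close> restores deleted endpoints.\<close>

lemma move_induces_colourings:
  assumes "move_region G H P R"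
  shows "induces_colourings R G H" "induces_colourings R H G"
proof -
  show "induces_colourings R G H"
    using assms unfolding move_region_def by (intro induces_colourings_region[of G H P R]) blast+
  show "induces_colourings R H G"
    using assms unfolding move_region_def by (intro induces_colourings_region[of H G P R]) auto
qed

section \<open>The parity axioms\<close>

lemma parity_uninvolved:
  assumes m: "move_region G H P R" and w: "orientation (circles G) w"
    and t: "transported R G C H C'" and c: "c \<in> chords G \<inter> chords H"
  shows "chord_parity H w C' c = chord_parity G w C c"
proof (rule chord_parity_cong)
  fix p assume pc: "p \<in> c"
  have G: "finite_ends G" and H: "finite_ends H" and I: "circles H = circles G"
    using m by (simp_all add: move_region_def)
  have pE: "p \<in> endpoints G" using pc c by (auto simp: endpoints_def)
  then have p: "p \<in> core G" using G finite_ends_core by blast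
  \<comment> \<open>An end of a common chord is off \<open>P\<close>, and endpoints of
    \<open>G\<close> in \<open>R\<close> lie in \<open>P\<close>. So just before \<open>p\<close>
    there are points outside \<open>R\<close>, where the two colourings agree.\<close>
  have pP: "p \<notin> P" and pR: "p \<notin> R" using m pc c pE unfolding move_region_def by blast+
  define e where "e = - w (fst p)"
  have "fst p \<in> circles G" using p by (auto simp: circle_union_def)
  then have e: "e \<in> {1, -1}" using w by (auto simp: orientation_def e_def)
  have "\<forall>\<^sub>F s in at_right 0. shift p (e * s) \<in> R \<longleftrightarrow> p \<in> R"
    using m p pP e unfolding move_region_def region_def by blast
  moreover have "\<forall>\<^sub>F s in at_right 0. shift p (e * s) \<notin> endpoints G \<union> endpoints H"
    using G H by (intro eventually_shift_notin[OF _ p e]) (auto simp: finite_ends_def)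
  moreover have "\<forall>\<^sub>F s in at_right 0. interval_of G (shift p (e * s)) = side G p e"
    by (rule eventually_interval_of_shift[OF G p e])
  moreover have "\<forall>\<^sub>F s in at_right 0. interval_of H (shift p (e * s)) = side H p e"
    using p I by (intro eventually_interval_of_shift[OF H _ e]) simp
  ultimately have "\<forall>\<^sub>F s::real in at_right 0. C' (side H p e) = C (side G p e)"
  proof eventually_elim
    case (elim s)
    then have "shift p (e * s) \<in> core G - (endpoints G \<union> endpoints H \<union> R)"
      using p pR by simp
    then show ?case using t elim unfolding transported_def by metis
  qed
  then show "C' (preceding H w p) = C (preceding G w p)"
    by (simp add: preceding_def e_def)
qed

lemma parity_move1:
  assumes "finite_ends G" "orientation (circles G) w" "move1 G c R H" "two_colouring G C"
  shows "chord_parity G w C c = 0"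
proof -
  obtain p q A where "c = {p, q}" "adjacent_via G A p q"
    using assms(3) unfolding move1_def by blast
  then show ?thesis
    using adjacent_preceding[OF assms(1,2,4)] by (simp add: chord_parity_pair)
qed

text \<open>Passing from \<open>c1\<close> to \<open>c2\<close> flips both of the compared colours,
  so the comparison gives the same result.\<close>

lemma parity_move2:
  assumes "finite_ends G" "orientation (circles G) w" "move2 G c1 c2 R H" "two_colouring G C"
  shows "chord_parity G w C c1 = chord_parity G w C c2"
proof -
  obtain p1 q1 p2 q2 A B where m: "c1 = {p1, q1}" "c2 = {p2, q2}"
    "adjacent_via G A p1 p2" "adjacent_via G B q1 q2"
    using assms(3) unfolding move2_def by (elim conjE exE) (rule that)
  show ?thesis
    using adjacent_preceding[OF assms(1,2,4) m(3)] adjacent_preceding[OF assms(1,2,4) m(4)]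
    unfolding m(1,2) chord_parity_pair by auto
qed

lemma same_endpoints:
  assumes "circles H = circles G" "endpoints H = endpoints G"
  shows "intervals H = intervals G" "interval_of H = interval_of G" "side H = side G"
    "preceding H = preceding G"
proof -
  show i: "intervals H = intervals G" by (simp add: intervals_def assms)
  show "interval_of H = interval_of G" by (simp add: interval_of_def assms fun_eq_iff)
  show s: "side H = side G" by (simp add: side_def i fun_eq_iff)
  show "preceding H = preceding G" by (simp add: preceding_def s fun_eq_iff)
qed

text \<open>Each end of a chord moves to the position of its adjacent partner, where the preceding
  colour is the opposite one. Both ends of the chord are flipped, so its parity is kept.\<close>

lemma parity_move3:
  assumes G: "simple_gauss G" and w: "orientation (circles G) w"
    and m: "move3 G (c1, c2, c3) R H (c1', c2', c3')" and t: "transported R G C H C'"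
  shows "card {c \<in> {c1, c2, c3}. chord_parity G w C c = 1} \<in> {0, 2, 3}"
    "chord_parity H w C' c1' = chord_parity G w C c1"
    "chord_parity H w C' c2' = chord_parity G w C c2"
    "chord_parity H w C' c3' = chord_parity G w C c3"
proof -
  have fe: "finite_ends G" using G by (rule simple_gauss_finite_ends)
  obtain a1 a2 b1 b2 d1 d2 A B E where n:
    "c1 = {a1, a2}" "c2 = {b1, b2}" "c3 = {d1, d2}"
    "c1' = {b1, d1}" "c2' = {a1, d2}" "c3' = {a2, b2}"
    "c1 \<in> chords G" "c2 \<in> chords G" "c3 \<in> chords G" "distinct [c1, c2, c3]"
    "distinct [a1, a2, b1, b2, d1, d2]"
    "adjacent_via G A a1 b1" "adjacent_via G B a2 d1" "adjacent_via G E b2 d2"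
    "circles H = circles G" "chords H = chords G - {c1, c2, c3} \<union> {c1', c2', c3'}"
    "endpoints H = endpoints G"
    "R = A \<union> B \<union> E \<union> {a1, a2, b1, b2, d1, d2}"
    using m by (rule move3E[OF G])
  note same = same_endpoints[OF n(15,17)]
  have C: "two_colouring G C" using t by (simp add: transported_def)
  then have "two_colouring H C" unfolding two_colouring_def n(17) same by simp
  \<comment> \<open>The endpoints, and with them the intervals, are the same for \<open>H\<close>
    and \<open>G\<close>, so \<open>C\<close> is a transport of itself. Uniqueness then identifies
    \<open>C'\<close> with \<open>C\<close> on intervals.\<close>
  then have tC: "transported R G C H C" using C by (simp add: transported_def same)
  obtain P where P: "move_region G H P R" using move3_region[OF G m] by blast
  have CC': "C' A = C A" if "A \<in> intervals G" for A
    using transport_unique[OF _ _ _ _ tC t, of P A] that P same(1) unfolding move_region_def by metis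
  have pre: "preceding G w p \<in> intervals G" if "p \<in> endpoints G" for p
  proof -
    have "p \<in> core G" using finite_ends_core[OF fe that] .
    moreover have "- w (fst p) \<in> {1, -1}"
      using calculation w by (auto simp: circle_union_def orientation_def)
    ultimately show ?thesis unfolding preceding_def using side_spec(1)[OF fe] by blast
  qed
  have ends: "{a1, b1, a2, d1, b2, d2} \<subseteq> endpoints G"
    using n(12-14) by (simp add: adjacent_via_def)
  define x where "x p = C (preceding G w p)" for p
  have x': "C' (preceding H w p) = x p" if "p \<in> endpoints G" for p
    using CC' pre that by (simp add: same x_def)
  have adj: "x a1 \<noteq> x b1" "x a2 \<noteq> x d1" "x b2 \<noteq> x d2"
    using adjacent_preceding[OF fe w C] n(12-14) by (simp_all add: x_def)
  have par: "chord_parity G w C c1 = (if x a1 = x a2 then 1 else 0)"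
    "chord_parity G w C c2 = (if x b1 = x b2 then 1 else 0)"
    "chord_parity G w C c3 = (if x d1 = x d2 then 1 else 0)"
    by (simp_all add: n(1-3) chord_parity_pair x_def)
  have par': "chord_parity H w C' c1' = (if x b1 = x d1 then 1 else 0)"
    "chord_parity H w C' c2' = (if x a1 = x d2 then 1 else 0)"
    "chord_parity H w C' c3' = (if x a2 = x b2 then 1 else 0)"
    using ends by (simp_all add: n(4-6) chord_parity_pair x')
  show "chord_parity H w C' c1' = chord_parity G w C c1"
    "chord_parity H w C' c2' = chord_parity G w C c2"
    "chord_parity H w C' c3' = chord_parity G w C c3"
    unfolding par par' using adj by auto
  have distinct: "c1 \<noteq> c2" "c1 \<noteq> c3" "c2 \<noteq> c3" using n(10) by simp_all
  have "{c \<in> {c1, c2, c3}. chord_parity G w C c = 1} =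
      (if x a1 = x a2 then {c1} else {}) \<union> (if x b1 = x b2 then {c2} else {}) \<union>
      (if x d1 = x d2 then {c3} else {})"
    using par by auto
  \<comment> \<open>With \<open>X\<close>, \<open>Y\<close>, \<open>Z\<close> for
    \<open>x a1\<close>, \<open>x a2\<close>, \<open>x b2\<close>, the flips in \<open>adj\<close>
    make the three chords even iff \<open>X \<noteq> Y\<close>, \<open>X = Z\<close> and
    \<open>Y \<noteq> Z\<close>, respectively. An odd number of these three always holds.\<close>
  also have "card \<dots> \<in> {0, 2}"
    using adj distinct by (cases "x a1"; cases "x a2"; cases "x b2") simp_all
  finally show "card {c \<in> {c1, c2, c3}. chord_parity G w C c = 1} \<in> {0, 2, 3}" by blast
qed

section \<open>Homeomorphisms and free links\<close>

lemma orientation_sign: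
  "orientation (circles G) w \<Longrightarrow> p \<in> core G \<Longrightarrow> w (fst p) = 1 \<or> w (fst p) = -1"
  by (auto simp: orientation_def circle_union_def)

text \<open>The image of \<open>A\<close> is connected and lies in one interval \<open>B\<close>;
  the inverse carries \<open>B\<close> back into \<open>A\<close> for the same reason.\<close>

lemma homeomorphism_interval:
  assumes hom: "homeomorphism (core G) (core H) f g" and E: "endpoints H = f ` endpoints G"
    and sub: "endpoints G \<subseteq> core G" and A: "A \<in> intervals G"
  shows "f ` A \<in> intervals H"
proof -
  have inj: "inj_on f (core G)" using hom by (metis homeomorphism_def inj_on_inverseI)
  have "f ` (core G - endpoints G) = core H - endpoints H"
    using hom inj_on_image_set_diff[OF inj, of "core G" "endpoints G"] sub E
    by (simp add: homeomorphism_def)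
  then have hom': "homeomorphism (core G - endpoints G) (core H - endpoints H) f g"
    using hom homeomorphism_of_subsets[of "core G" "core H" f g "core G - endpoints G"] by blast
  obtain x where x: "x \<in> A" using A interval_nonempty by blast
  then have xG: "x \<in> core G - endpoints G" using intervals_subset[OF A] by blast
  then have fx: "f x \<in> core H - endpoints H" using hom' by (auto simp: homeomorphism_def)
  define B where "B = interval_of H (f x)"
  have B: "B \<in> intervals H" "f x \<in> B"
    unfolding B_def using fx interval_of_in_intervals in_interval_of by blast+
  have "connected (f ` A)"
    using connected_continuous_image continuous_on_subset[OF homeomorphism_cont1[OF hom'] intervals_subset[OF A]]
      interval_connected[OF A] by blast
  then have 1: "f ` A \<subseteq> B" unfolding B_def
    using x intervals_subset[OF A] homeomorphism_image1[OF hom']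
    by (intro connected_subset_interval_of) blast+
  have "connected (g ` B)"
    using connected_continuous_image continuous_on_subset[OF homeomorphism_cont2[OF hom'] intervals_subset[OF B(1)]]
      interval_connected[OF B(1)] by blast
  moreover have "g ` B \<subseteq> core G - endpoints G"
    using intervals_subset[OF B(1)] homeomorphism_image2[OF hom'] by blast
  moreover have "x \<in> g ` B" using B(2) homeomorphism_apply1[OF hom' xG] by force
  ultimately have "g ` B \<subseteq> A"
    using connected_subset_interval_of[of "g ` B" G x] interval_of_eq[OF A x] by simp
  then have "f ` g ` B \<subseteq> f ` A" by blast
  moreover have "f ` g ` B = B"
    using homeomorphism_apply2[OF hom'] intervals_subset[OF B(1)] by (force simp: image_image)
  ultimately show ?thesis using 1 B(1) by (simp add: subset_antisym)
qed

lemma oriented_isoE: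
  assumes "oriented_iso f (G, w) (H, v)"
  obtains g where "homeomorphism (core G) (core H) f g" "endpoints H = f ` endpoints G"
    "\<forall>p\<in>core G. \<forall>e\<in>{1, -1}. \<forall>\<^sub>F s in at_right 0. \<exists>u\<in>{0<..<pi}.
        f (shift p (e * w (fst p) * s)) = shift (f p) (e * v (fst (f p)) * u)"
proof -
  obtain g where g: "homeomorphism (core G) (core H) f g" "chords H = image f ` chords G"
    and e: "\<forall>p\<in>core G. \<forall>e\<in>{1, -1}. \<forall>\<^sub>F s in at_right 0. \<exists>u\<in>{0<..<pi}.
        f (shift p (e * w (fst p) * s)) = shift (f p) (e * v (fst (f p)) * u)"
    using assms unfolding oriented_iso_def prod.case by blast
  have "endpoints H = f ` endpoints G" using g(2) by (auto simp: endpoints_def)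
  then show thesis using that g(1) e by blast
qed

text \<open>Lets a statement about points near \<open>f p\<close> be pulled back to small angles at
  \<open>p\<close>. Injectivity keeps the image away from \<open>f p\<close>.\<close>

lemma tendsto_homeomorphism_shift:
  assumes hom: "homeomorphism (core G) (core H) f g" and p: "p \<in> core G" and e: "e \<in> {1, -1}"
  shows "filterlim (\<lambda>s. f (shift p (e * s))) (at (f p) within core H) (at_right 0)"
  unfolding filterlim_at
proof
  have "((\<lambda>s. shift p (e * s)) \<longlongrightarrow> shift p (e * 0)) (at_right 0)"
    unfolding shift_def by (intro tendsto_intros)
  then have "((\<lambda>s. shift p (e * s)) \<longlongrightarrow> p) (at_right 0)" by simp
  then show "((\<lambda>s. f (shift p (e * s))) \<longlongrightarrow> f p) (at_right 0)"
    using p by (intro continuous_on_tendsto_compose[OF homeomorphism_cont1[OF hom]]) auto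
  have "\<forall>\<^sub>F s in at_right 0. shift p (e * s) \<notin> {p}"
    by (rule eventually_shift_notin[OF _ p e]) simp
  then show "\<forall>\<^sub>F s in at_right 0. f (shift p (e * s)) \<in> core H \<and> f (shift p (e * s)) \<noteq> f p"
  proof eventually_elim
    case (elim s)
    have "shift p (e * s) \<in> core G" using p by simp
    then show ?case
      using elim p homeomorphism_image1[OF hom] homeomorphism_apply1[OF hom] by (metis image_eqI singletonI)
  qed
qed

text \<open>\<open>oriented_iso\<close> fixes the direction in which the image leaves
  \<open>f p\<close>, but bounds the angle only by \<open>pi\<close>. Continuity gives a small angle
  without a direction. Comparing the two puts the image on the correct side and close to
  \<open>f p\<close>.\<close>

lemma iso_side:
  assumes G: "finite_ends G" and H: "finite_ends H"
    and w: "orientation (circles G) w" and v: "orientation (circles H) v"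
    and iso: "oriented_iso f (G, w) (H, v)" and p: "p \<in> core G" and e: "e \<in> {1, -1}"
  shows "f ` side G p (e * w (fst p)) = side H (f p) (e * v (fst (f p)))"
proof -
  obtain g where hom: "homeomorphism (core G) (core H) f g" and E: "endpoints H = f ` endpoints G"
    and ori: "\<forall>p\<in>core G. \<forall>e\<in>{1, -1}. \<forall>\<^sub>F s in at_right 0. \<exists>u\<in>{0<..<pi}.
        f (shift p (e * w (fst p) * s)) = shift (f p) (e * v (fst (f p)) * u)"
    by (rule oriented_isoE[OF iso])
  have fp: "f p \<in> core H" using p homeomorphism_image1[OF hom] by blast
  define a b where "a = e * w (fst p)" and "b = e * v (fst (f p))"
  have a: "a \<in> {1, -1}" and b: "b \<in> {1, -1}"
    using orientation_sign[OF w p] orientation_sign[OF v fp] e by (auto simp: a_def b_def)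
  have A: "side G p a \<in> intervals G" by (rule side_spec(1)[OF G p a])
  have B: "side H (f p) b \<in> intervals H" by (rule side_spec(1)[OF H fp b])
  obtain d where d: "d > 0" "\<And>u. 0 < u \<Longrightarrow> u < d \<Longrightarrow> shift (f p) (b * u) \<in> side H (f p) b"
    using side_spec(2)[OF H fp b] unfolding eventually_at_right_field by blast
  have "\<forall>\<^sub>F y in at (f p) within core H. \<exists>t. \<bar>t\<bar> < min d pi \<and> y = shift (f p) t"
    by (rule eventually_near_shift[OF fp]) (use d(1) in simp)
  then have "\<forall>\<^sub>F s in at_right 0. \<exists>t. \<bar>t\<bar> < min d pi \<and> f (shift p (a * s)) = shift (f p) t"
    using tendsto_homeomorphism_shift[OF hom p a] by (rule eventually_compose_filterlim)
  moreover have "\<forall>\<^sub>F s in at_right 0. \<exists>u\<in>{0<..<pi}. f (shift p (a * s)) = shift (f p) (b * u)"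
    unfolding a_def b_def by (rule bspec[OF bspec[OF ori p] e])
  moreover have "\<forall>\<^sub>F s in at_right 0. shift p (a * s) \<in> side G p a"
    by (rule side_spec(2)[OF G p a])
  ultimately have "\<forall>\<^sub>F s in at_right 0. f (shift p (a * s)) \<in> f ` side G p a \<inter> side H (f p) b"
  proof eventually_elim
    case (elim s)
    then obtain t u where t: "\<bar>t\<bar> < min d pi" "f (shift p (a * s)) = shift (f p) t"
      and u: "0 < u" "u < pi" "f (shift p (a * s)) = shift (f p) (b * u)"
      by auto
    have "cis t = cis (b * u)" using t(2) u(3) shift_eq_iff[OF fp] by metis
    \<comment> \<open>Both angles are below \<open>pi\<close> in absolute value; this is why
      \<open>pi\<close> enters the minimum with \<open>d\<close>.\<close>
    moreover have "\<bar>t - b * u\<bar> < 2 * pi" using t(1) u(1,2) b by auto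
    ultimately have "t = b * u" by (rule cis_inj)
    then have "u < d" using t(1) u(1) b by auto
    then show ?case using d(2)[OF u(1)] u(3) imageI[OF elim(3), of f] by simp
  qed
  then obtain s where "f (shift p (a * s)) \<in> f ` side G p a \<inter> side H (f p) b"
    using eventually_happens'[OF trivial_limit_at_right_real] by blast
  moreover have "f ` side G p a \<in> intervals H"
    using homeomorphism_interval[OF hom E _ A] G by (simp add: finite_ends_def)
  ultimately show ?thesis
    using intervals_unique[OF _ B] unfolding a_def b_def by blast
qed

text \<open>If the orientation signs at \<open>p\<close> and \<open>f p\<close> differ,
  \<open>f\<close> swaps anticlockwise and clockwise sides; requiring different colours on the two
  sides is symmetric in them.\<close>

lemma iso_two_colouring_iff:
  assumes G: "finite_ends G" and H: "finite_ends H"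
    and w: "orientation (circles G) w" and v: "orientation (circles H) v"
    and iso: "oriented_iso f (G, w) (H, v)"
  shows "two_colouring G (\<lambda>A. C (f ` A)) \<longleftrightarrow> two_colouring H C"
proof -
  have E: "endpoints H = f ` endpoints G" using oriented_isoE[OF iso] by metis
  have "C (f ` side G p 1) \<noteq> C (f ` side G p (-1)) \<longleftrightarrow>
      C (side H (f p) 1) \<noteq> C (side H (f p) (-1))" if "p \<in> endpoints G" for p
  proof -
    have p: "p \<in> core G" and fp: "f p \<in> core H"
      using that E finite_ends_core[OF G] finite_ends_core[OF H] by blast+
    show ?thesis
      using iso_side[OF assms p, of 1] iso_side[OF assms p, of "-1"]
        orientation_sign[OF w p] orientation_sign[OF v fp]
      by (elim disjE) auto
  qed
  then show ?thesis unfolding two_colouring_def E by auto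
qed

text \<open>Colours are pushed forward through the inverse \<open>g\<close>. It suffices that
  \<open>g\<close> undoes \<open>f\<close> on intervals, so the behaviour of \<open>g\<close> with
  respect to orientations is never examined.\<close>

lemma iso_two_colouring_back:
  assumes "finite_ends G" "finite_ends H" "orientation (circles G) w" "orientation (circles H) v"
    "oriented_iso f (G, w) (H, v)" "two_colouring G C"
  shows "\<exists>C'. two_colouring H C'"
proof -
  obtain g where hom: "homeomorphism (core G) (core H) f g" using oriented_isoE[OF assms(5)] by metis
  have "C (g ` f ` A) = C A" if "A \<in> intervals G" for A
  proof -
    have "g ` f ` A = A"
      using homeomorphism_apply1[OF hom] intervals_subset[OF that] by (force simp: image_image)
    then show ?thesis by simp
  qed
  then have "two_colouring G (\<lambda>A. C (g ` f ` A))"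
    using assms(6) side_spec(1)[OF assms(1) finite_ends_core[OF assms(1)]]
    unfolding two_colouring_def by simp
  then show ?thesis
    using iso_two_colouring_iff[OF assms(1-5), of "\<lambda>A. C (g ` A)"] by blast
qed

lemma iso_chord_parity:
  assumes G: "finite_ends G" and H: "finite_ends H"
    and w: "orientation (circles G) w" and v: "orientation (circles H) v"
    and iso: "oriented_iso f (G, w) (H, v)" and c: "c \<in> chords G"
  shows "chord_parity G w (\<lambda>A. C (f ` A)) c = chord_parity H v C (f ` c)"
proof -
  have "f ` preceding G w p = preceding H v (f p)" if "p \<in> c" for p
  proof -
    have "p \<in> endpoints G" using that c by (auto simp: endpoints_def)
    then have "p \<in> core G" by (rule finite_ends_core[OF G])
    then show ?thesis using iso_side[OF assms(1-5), of p "-1"] by (simp add: preceding_def)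
  qed
  then show ?thesis unfolding chord_parity_def by simp
qed

section \<open>Colourability along a free link\<close>

lemma diagram_finite_ends:
  "(G, w) \<in> oriented_diagrams \<Longrightarrow> finite_ends G \<and> simple_gauss G \<and> orientation (circles G) w"
  by (simp add: oriented_diagrams_def simple_gauss_finite_ends)

lemma free_step_colourable:
  assumes "((G, w), (H, v)) \<in> free_step"
  shows "(\<exists>C. two_colouring G C) \<longleftrightarrow> (\<exists>C. two_colouring H C)"
proof -
  have G: "finite_ends G" "simple_gauss G" "orientation (circles G) w"
    and H: "finite_ends H" "simple_gauss H" "orientation (circles H) v"
    and step: "(\<exists>R. move R G H) \<and> v = w \<or> (\<exists>f. oriented_iso f (G, w) (H, v))"
    using assms diagram_finite_ends by (auto simp: free_step_def)
  show ?thesis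
    using step
  proof (elim disjE conjE exE)
    fix R assume "move R G H"
    then obtain P where "move_region G H P R" using move_region_exists[OF G(2)] by blast
    then show ?thesis
      using move_induces_colourings unfolding induces_colourings_def transported_def by metis
  next
    fix f assume iso: "oriented_iso f (G, w) (H, v)"
    show ?thesis
      using iso_two_colouring_iff[OF G(1) H(1) G(3) H(3) iso]
        iso_two_colouring_back[OF G(1) H(1) G(3) H(3) iso] by blast
  qed
qed

lemma free_link_diagrams:
  assumes "L \<in> oriented_free_links"
  shows "L \<subseteq> oriented_diagrams"
proof -
  obtain x where x: "x \<in> oriented_diagrams" "L = ((free_step \<union> free_step\<inverse>)\<^sup>*) `` {x}"
    using assms unfolding oriented_free_links_def by (blast elim: quotientE)
  have "y \<in> oriented_diagrams" if "(x, y) \<in> (free_step \<union> free_step\<inverse>)\<^sup>*" for y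
    using that x(1) by induction (auto simp: free_step_def)
  then show ?thesis using x(2) by blast
qed

text \<open>\<open>two_colourable\<close> provides a colouring of one representative only;
  colourability is then carried along chains of steps and inverse steps to every other one.\<close>

lemma free_link_colourable:
  assumes L: "L \<in> oriented_free_links" and "two_colourable L" and X: "(G, w) \<in> L"
  shows "\<exists>C. two_colouring G C"
proof -
  let ?r = "(free_step \<union> free_step\<inverse>)\<^sup>*"
  have step: "(\<exists>C. two_colouring (fst y) C) \<longleftrightarrow> (\<exists>C. two_colouring (fst z) C)"
    if "(y, z) \<in> free_step \<union> free_step\<inverse>" for y z
  proof -
    have "(y, z) \<in> free_step \<or> (z, y) \<in> free_step" using that by blast
    then show ?thesis
      using free_step_colourable[of "fst y" "snd y" "fst z" "snd z"]
        free_step_colourable[of "fst z" "snd z" "fst y" "snd y"] by (simp only: prod.collapse) blast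
  qed
  have all: "(\<exists>C. two_colouring (fst y) C) \<longleftrightarrow> (\<exists>C. two_colouring (fst z) C)"
    if "(y, z) \<in> ?r" for y z
    using that by induction (use step in blast)+
  obtain x where "L = ?r `` {x}"
    using L unfolding oriented_free_links_def by (blast elim: quotientE)
  moreover obtain Y where "Y \<in> L" "\<exists>C. two_colouring (fst Y) C"
    using assms(2) unfolding two_colourable_def by fastforce
  ultimately show ?thesis using X all by (metis Image_singleton_iff fst_conv)
qed

lemma parity_on_free_link:
  assumes L: "L \<in> oriented_free_links"
  shows "parity_on L chord_parity"
proof -
  have D: "finite_ends G" "simple_gauss G" "orientation (circles G) w" if "(G, w) \<in> L" for G w
    using free_link_diagrams[OF L] that diagram_finite_ends by blast+
  show ?thesis
    unfolding parity_on_def Ball_def split_paired_All prod.case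
  proof (intro conjI allI impI)
    fix G w C c
    show "chord_parity G w C c \<in> {0, 1}" by (simp add: chord_parity_def)
  next
    fix G w H v f C
    assume GL: "(G, w) \<in> L" "(H, v) \<in> L"
      and iso: "oriented_iso f (G, w) (H, v) \<and> two_colouring H C"
    note GH = D(1)[OF GL(1)] D(1)[OF GL(2)] D(3)[OF GL(1)] D(3)[OF GL(2)] conjunct1[OF iso]
    show "two_colouring G (\<lambda>A. C (f ` A))"
      using iso_two_colouring_iff[OF GH] iso by blast
    show "chord_parity G w (\<lambda>A. C (f ` A)) c = chord_parity H v C (f ` c)" if "c \<in> chords G" for c
      by (rule iso_chord_parity[OF GH that])
  next
    fix G w R H C C' c
    assume GL: "(G, w) \<in> L" and m: "move R G H \<and> transported R G C H C'"
      and c: "c \<in> chords G \<inter> chords H"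
    obtain P where "move_region G H P R" using move_region_exists[OF D(2)[OF GL]] m by blast
    then show "chord_parity H w C' c = chord_parity G w C c"
      using m c by (intro parity_uninvolved[OF _ D(3)[OF GL]]) blast+
  next
    fix G w R H C c
    assume GL: "(G, w) \<in> L" and "move1 G c R H \<and> two_colouring G C"
    then show "chord_parity G w C c = 0" using parity_move1[OF D(1,3)[OF GL]] by blast
  next
    fix G w R H C c1 c2
    assume GL: "(G, w) \<in> L" and "move2 G c1 c2 R H \<and> two_colouring G C"
    then show "chord_parity G w C c1 = chord_parity G w C c2"
      using parity_move2[OF D(1,3)[OF GL]] by blast
  next
    fix G w R H C C' c1 c2 c3 c1' c2' c3'
    assume GL: "(G, w) \<in> L" and m: "move3 G (c1, c2, c3) R H (c1', c2', c3') \<and> transported R G C H C'"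
    note par = parity_move3[OF D(2,3)[OF GL] conjunct1[OF m] conjunct2[OF m]]
    show "card {c \<in> {c1, c2, c3}. chord_parity G w C c = 1} \<in> {0, 2, 3}" by (rule par)
    show "chord_parity H w C' c1' = chord_parity G w C c1" by (rule par)
    show "chord_parity H w C' c2' = chord_parity G w C c2" by (rule par)
    show "chord_parity H w C' c3' = chord_parity G w C c3" by (rule par)
  qed
qed

section \<open>Virtual link diagrams\<close>

lemma circles_gauss_of [simp]: "circles (gauss_of D) = comps D"
  by (simp add: gauss_of_def)

lemma gauss_of_endpoints:
  "endpoints (gauss_of D) = {p \<in> circle_union (comps D). immersion D p \<in> classical D}"
  by (auto simp: gauss_of_def endpoints_def strands_def)

lemma arcs_eq: "arcs D = image (immersion D) ` intervals (gauss_of D)"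
proof -
  have "core (gauss_of D) - endpoints (gauss_of D) =
      {p \<in> circle_union (comps D). immersion D p \<notin> classical D}"
    by (auto simp: gauss_of_endpoints)
  then show ?thesis by (simp add: arcs_def intervals_def)
qed

lemma gauss_of_simple:
  assumes "virtual_diagram D"
  shows "simple_gauss (gauss_of D)"
proof -
  have D: "finite (comps D)" "finite (crossings D)" "\<forall>x\<in>crossings D. card (strands D x) = 2"
    "classical D \<subseteq> crossings D"
    using assms unfolding virtual_diagram_def by blast+
  have "pairwise disjnt (strands D ` classical D)"
    by (auto simp: pairwise_def disjnt_def strands_def)
  moreover have "finite (classical D)" using D(2,4) by (rule rev_finite_subset)
  moreover have "\<forall>x\<in>classical D. card (strands D x) = 2" using D by blast
  moreover have "strands D x \<subseteq> circle_union (comps D)" for x by (auto simp: strands_def)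
  ultimately show ?thesis using D(1) unfolding simple_gauss_def by (simp add: gauss_of_def)
qed

lemma finite_multiple_points:
  assumes "virtual_diagram D"
  shows "finite {p \<in> circle_union (comps D). immersion D p \<in> crossings D}"
proof -
  have D: "finite (crossings D)" "\<forall>x\<in>crossings D. card (strands D x) = 2"
    using assms unfolding virtual_diagram_def by blast+
  have "finite (strands D x)" if "x \<in> crossings D" for x
    using D(2) that by (intro card_ge_0_finite) simp
  then have "finite (\<Union> (strands D ` crossings D))" using D(1) by blast
  moreover have "{p \<in> circle_union (comps D). immersion D p \<in> crossings D} = \<Union> (strands D ` crossings D)"
    by (auto simp: strands_def)
  ultimately show ?thesis by simp
qed

text \<open>A point of the plane that is no crossing has a single preimage, which determines the
  interval. At a virtual crossing two arcs may meet, so the test point has to avoid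
  crossings.\<close>

lemma interval_of_arc_point:
  assumes "A \<in> intervals (gauss_of D)" "B \<in> intervals (gauss_of D)" "x \<in> A"
    "immersion D x \<notin> crossings D" "immersion D x \<in> immersion D ` B"
  shows "A = B"
proof -
  obtain y where y: "y \<in> B" "immersion D y = immersion D x" using assms(5) by force
  have "x \<in> circle_union (comps D)" "y \<in> circle_union (comps D)"
    using intervals_subset[OF assms(1)] intervals_subset[OF assms(2)] assms(3) y(1) by auto
  then have "x = y" using assms(4) y(2) unfolding crossings_def strands_def by blast
  then show ?thesis using intervals_unique[OF assms(1,2,3)] y(1) by blast
qed

text \<open>Uniqueness in the description of \<open>arc_at\<close>: points just beyond
  \<open>p\<close> lie over no crossing, not even a virtual one, so any arc containing them comes
  from the side of \<open>p\<close>.\<close>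

lemma arc_at_eq:
  assumes D: "virtual_diagram D" and p: "p \<in> circle_union (comps D)" and e: "e \<in> {1, -1}"
  shows "arc_at D p e = immersion D ` side (gauss_of D) p e"
  unfolding arc_at_def
proof (rule the_equality)
  have G: "finite_ends (gauss_of D)" using simple_gauss_finite_ends gauss_of_simple[OF D] .
  have pc: "p \<in> core (gauss_of D)" using p by simp
  note S = side_spec[OF G pc e]
  show "immersion D ` side (gauss_of D) p e \<in> arcs D \<and>
      (\<forall>\<^sub>F s in at_right 0. immersion D (shift p (e * s)) \<in> immersion D ` side (gauss_of D) p e)"
    using S(1) by (auto simp: arcs_eq intro: eventually_mono[OF S(2)])
  fix a assume a: "a \<in> arcs D \<and> (\<forall>\<^sub>F s in at_right 0. immersion D (shift p (e * s)) \<in> a)"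
  then obtain B where B: "B \<in> intervals (gauss_of D)" "a = immersion D ` B" by (auto simp: arcs_eq)
  have "\<forall>\<^sub>F s in at_right 0. shift p (e * s) \<notin> {p \<in> circle_union (comps D). immersion D p \<in> crossings D}"
    by (rule eventually_shift_notin[OF finite_multiple_points[OF D] p e])
  with a S(2) have "\<forall>\<^sub>F s in at_right 0. immersion D (shift p (e * s)) \<in> a \<and>
      shift p (e * s) \<in> side (gauss_of D) p e \<and> immersion D (shift p (e * s)) \<notin> crossings D"
    using p by (auto intro: eventually_conj)
  then obtain s where "immersion D (shift p (e * s)) \<in> a" "shift p (e * s) \<in> side (gauss_of D) p e"
      "immersion D (shift p (e * s)) \<notin> crossings D"
    using eventually_happens'[OF trivial_limit_at_right_real] by blast
  then show "a = immersion D ` side (gauss_of D) p e"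
    using interval_of_arc_point[OF S(1) B(1)] B(2) by blast
qed

lemma arc_image_inj:
  assumes D: "virtual_diagram D"
  shows "inj_on (image (immersion D)) (intervals (gauss_of D))"
proof (rule inj_onI)
  fix A B assume A: "A \<in> intervals (gauss_of D)" and B: "B \<in> intervals (gauss_of D)"
    and eq: "immersion D ` A = immersion D ` B"
  have G: "finite_ends (gauss_of D)" using simple_gauss_finite_ends gauss_of_simple[OF D] .
  obtain x where x: "x \<in> A" using A interval_nonempty by blast
  then have xG: "x \<in> core (gauss_of D) - endpoints (gauss_of D)" using intervals_subset[OF A] by blast
  \<comment> \<open>The chosen \<open>x\<close> may lie over a virtual crossing, so it is replaced
    by a nearby point of \<open>A\<close> that does not.\<close>
  have "\<forall>\<^sub>F s in at_right 0. shift x (1 * s) \<in> A"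
    using side_spec(2)[OF G, of x 1] side_interior[OF G xG, of 1] interval_of_eq[OF A x] xG by simp
  moreover have "\<forall>\<^sub>F s in at_right 0. shift x (1 * s) \<notin> {p \<in> circle_union (comps D). immersion D p \<in> crossings D}"
    using xG by (intro eventually_shift_notin[OF finite_multiple_points[OF D]]) auto
  ultimately have "\<forall>\<^sub>F s in at_right 0. shift x (1 * s) \<in> A \<and> immersion D (shift x (1 * s)) \<notin> crossings D"
    by eventually_elim (use xG in auto)
  then obtain y where "y \<in> A" "immersion D y \<notin> crossings D"
    using eventually_happens'[OF trivial_limit_at_right_real] by blast
  then show "A = B" using interval_of_arc_point[OF A B] eq by blast
qed

lemma diagram_colouring_iff:
  assumes D: "virtual_diagram D" and KC: "corresponds D K C"
  shows "diagram_colouring D K \<longleftrightarrow> two_colouring (gauss_of D) C"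
proof -
  have G: "finite_ends (gauss_of D)" using simple_gauss_finite_ends gauss_of_simple[OF D] .
  have "K (arc_at D p e) = C (side (gauss_of D) p e)" if "p \<in> circle_union (comps D)" "e \<in> {1, -1}" for p e
    using arc_at_eq[OF D that] KC side_spec(1)[OF G _ that(2)] that(1) by (simp add: corresponds_def)
  moreover have "(\<forall>x\<in>classical D. \<forall>p\<in>strands D x. Q p) \<longleftrightarrow> (\<forall>p\<in>endpoints (gauss_of D). Q p)" for Q
    by (auto simp: gauss_of_endpoints strands_def)
  ultimately show ?thesis
    unfolding diagram_colouring_def two_colouring_def gauss_of_endpoints by simp
qed

lemma corresponding_diagram_colouring:
  assumes D: "virtual_diagram D"
  shows "\<exists>K. corresponds D K C"
proof -
  \<comment> \<open>An arc comes from exactly one interval by \<open>arc_image_inj\<close>, so it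
    can take the colour of that interval.\<close>
  define K where "K a = C (the_inv_into (intervals (gauss_of D)) (image (immersion D)) a)" for a
  have "corresponds D K C"
    unfolding corresponds_def K_def using the_inv_into_f_f[OF arc_image_inj[OF D]] by simp
  then show ?thesis by blast
qed

lemma crossing_parity_eq:
  assumes D: "virtual_diagram D" and w: "orientation (comps D) w" and KC: "corresponds D K C"
  shows "chord_parity (gauss_of D) w C (strands D x) = crossing_parity D w K x"
proof -
  have G: "finite_ends (gauss_of D)" using simple_gauss_finite_ends gauss_of_simple[OF D] .
  have "K (arc_into D w p) = C (preceding (gauss_of D) w p)" if "p \<in> strands D x" for p
  proof -
    have p: "p \<in> circle_union (comps D)" using that by (simp add: strands_def)
    then have e: "- w (fst p) \<in> {1, -1}" using w by (auto simp: orientation_def circle_union_def)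
    show ?thesis
      using arc_at_eq[OF D p e] KC side_spec(1)[OF G _ e] p
      by (simp add: corresponds_def arc_into_def preceding_def)
  qed
  then show ?thesis unfolding chord_parity_def crossing_parity_def by simp
qed

theorem proposition5p10:
  shows
    "(\<forall>D. virtual_diagram D \<longrightarrow>
        simple_gauss (gauss_of D) \<and>
        (\<forall>K. diagram_colouring D K \<longrightarrow> (\<exists>C. two_colouring (gauss_of D) C \<and> corresponds D K C)) \<and>
        (\<forall>C. two_colouring (gauss_of D) C \<longrightarrow> (\<exists>K. diagram_colouring D K \<and> corresponds D K C)) \<and>
        (\<forall>w K C. orientation (comps D) w \<and> diagram_colouring D K \<and>
           two_colouring (gauss_of D) C \<and> corresponds D K C \<longrightarrow>
           (\<forall>x\<in>classical D.
              chord_parity (gauss_of D) w C (strands D x) = crossing_parity D w K x))) \<and>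
     (\<forall>L\<in>oriented_free_links. two_colourable L \<longrightarrow>
        (\<forall>(G, w)\<in>L. \<exists>C. two_colouring G C) \<and>
        (\<forall>(G, w)\<in>L. \<forall>R G'. move R G G' \<longrightarrow>
           induces_colourings R G G' \<and> induces_colourings R G' G) \<and>
        parity_on L chord_parity)"
proof (intro conjI allI impI ballI)
  fix D assume D: "virtual_diagram D"
  show "simple_gauss (gauss_of D)" by (rule gauss_of_simple[OF D])
  show "\<exists>C. two_colouring (gauss_of D) C \<and> corresponds D K C" if "diagram_colouring D K" for K
  proof -
    have "corresponds D K (\<lambda>A. K (immersion D ` A))" by (simp add: corresponds_def)
    then show ?thesis using diagram_colouring_iff[OF D] that by blast
  qed
  show "\<exists>K. diagram_colouring D K \<and> corresponds D K C" if "two_colouring (gauss_of D) C" for C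
    using corresponding_diagram_colouring[OF D] diagram_colouring_iff[OF D] that by blast
  show "chord_parity (gauss_of D) w C (strands D x) = crossing_parity D w K x"
    if "orientation (comps D) w \<and> diagram_colouring D K \<and> two_colouring (gauss_of D) C \<and>
      corresponds D K C" for w K C x
    using crossing_parity_eq[OF D] that by blast
next
  fix L assume L: "L \<in> oriented_free_links" and col: "two_colourable L"
  show "case X of (G, w) \<Rightarrow> \<exists>C. two_colouring G C" if "X \<in> L" for X
    using free_link_colourable[OF L col] that by (cases X) simp
  show "case X of (G, w) \<Rightarrow> \<forall>R G'. move R G G' \<longrightarrow>
      induces_colourings R G G' \<and> induces_colourings R G' G" if "X \<in> L" for X
  proof (cases X)
    case (Pair G w)
    then have G: "simple_gauss G" using free_link_diagrams[OF L] diagram_finite_ends that by blast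
    have "induces_colourings R G G' \<and> induces_colourings R G' G" if "move R G G'" for R G'
      using move_region_exists[OF G that] move_induces_colourings by blast
    then show ?thesis using Pair by simp
  qed
  show "parity_on L chord_parity" by (rule parity_on_free_link[OF L])
qed

end
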